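(* Let $d\ge 1$ and consider a self-exciting (Hawkes) point process on $\mathbb{R}^d$, in the Poisson cluster framework, with Poisson offspring intensity $\gamma(dx)$ and Poisson immigrant intensity $\nu(dx)$ on $(\mathbb{R}^d,\mathcal{B}(\mathbb{R}^d))$. For sufficiently integrable $f:\mathbb{R}^d\to\mathbb{R}$, the Probability Generating Functional $$G_z(f)=f(z)\,\mathbb{E}\Big[\prod_{x\in\xi}f(z+x)\Big]$$ of the branching process starting from a single point at $z\in\mathbb{R}^d$ satisfies $$G_z(f)=f(z)\exp\Big(\int_{\mathbb{R}^d}\big(G_{z+x}(f)-1\big)\,\gamma(dx)\Big),\qquad z\in\mathbb{R}^d,$$ and the Probability Generating Functional $G_\nu(f)$ of the Hawkes process with immigrant intensity $\nu(dz)$ is given by $$G_\nu(f)=\exp\Big(\int_{\mathbb{R}^d}\big(G_z(f)-1\big)\,\nu(dz)\Big).$$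
   Context: The processes are built on the space of locally finite configurations $\xi=\{x_i\}_{i\in I}\subset\mathbb{R}^d$ (that is, $\#(A\cap\xi)<\infty$ for all compact $A\in\mathcal{B}(\mathbb{R}^d)$), identified with the Radon point measures $\xi(dz)=\sum_{x\in\xi}\epsilon_x(dz)$, where $\epsilon_x$ is the Dirac measure at $x$. Branching mechanism: any point $y\in\mathbb{R}^d$ of the process, independently of the others, branches into a Poisson random sample centered at $y$, i.e. its offspring are the points $y+u$, where $u$ ranges over a Poisson point process on $\mathbb{R}^d$ with intensity measure $\gamma$; the offspring branch in turn by the same rule. In the definition of $G_z(f)$, $\xi$ denotes the configuration of all descendants (all generations $\ge 1$) of an ancestor placed at $0$, the ancestor itself being excluded, so that the cluster started from a single point at $z$ consists of $z$ together with the points $z+x$, $x\in\xi$. Hawkes process with immigrant intensity $\nu$: the immigrants form a Poisson point process on $\mathbb{R}^d$ with intensity measure $\nu$, each immigrant $z$ starts an independent cluster distributed as the cluster started from $z$ (including $z$), and the Hawkes process is the superposition of these clusters. Its Probability Generating Functional is $G_\nu(f)=\mathbb{E}\big[\prod_y f(y)\big]$, the product being over all points $y$ of the process. "Sufficiently integrable" is not made more precise: it means that $f$ is such that the expectations and integrals above are well defined. *)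

theory Defs
  imports "HOL-Probability.Probability"
begin

section \<open>Configurations\<close>

text \<open>
  A configuration \<open>{x\<^sub>i}\<close>, \<open>i \<in> I\<close>, is a pair of an index set and a labelling of the indices by
  points. Repeated points count with their multiplicity, as they do in the point measure.
\<close>

type_synonym ('i, 'a) config = "'i set \<times> ('i \<Rightarrow> 'a)"

definition dirac_sum :: "('i, 'a::topological_space) config \<Rightarrow> 'a measure" where
  "dirac_sum \<xi> = distr (count_space (fst \<xi>)) borel (snd \<xi>)"

definition locally_finite_config :: "('i, 'a::topological_space) config \<Rightarrow> bool" where
  "locally_finite_config \<xi> \<longleftrightarrow> (\<forall>K. compact K \<longrightarrow> finite {i \<in> fst \<xi>. snd \<xi> i \<in> K})"

definition config_prod :: "('a \<Rightarrow> real) \<Rightarrow> ('i, 'a) config \<Rightarrow> real" where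
  "config_prod f \<xi> = Lim (finite_subsets_at_top (fst \<xi>)) (\<lambda>F. \<Prod>i\<in>F. f (snd \<xi> i))"

text \<open>
  When the unordered product over a possibly infinite configuration counts as well defined: either
  all factors lie in \<open>[0, 1]\<close> (the product is then the infimum of the finite subproducts, and may
  be \<open>0\<close>), or the product converges absolutely. Finite configurations always qualify. Mere
  convergence of the net in \<open>config_prod\<close> would be too weak: independent factors with values \<open>0\<close>
  and \<open>2\<close> and mean \<open>1\<close> have an infinite product that is almost surely \<open>0\<close>, while the product of
  the means is \<open>1\<close>.
\<close>

definition config_prod_defined :: "('a \<Rightarrow> real) \<Rightarrow> ('i, 'a) config \<Rightarrow> bool" where
  "config_prod_defined f \<xi> \<longleftrightarrow>
     (\<forall>i\<in>fst \<xi>. 0 \<le> f (snd \<xi> i) \<and> f (snd \<xi> i) \<le> 1) \<or>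
     (\<lambda>i. \<bar>f (snd \<xi> i) - 1\<bar>) summable_on fst \<xi>"

section \<open>Poisson point processes\<close>

text \<open>
  A random locally finite configuration is given by a measurable enumeration of its points:
  \<open>(k, x)\<close> stands for the points \<open>x 0, x 1, \<dots>\<close> with index below \<open>k\<close>, where \<open>k = \<infinity>\<close> is allowed.
\<close>

type_synonym 'a sample = "enat \<times> (nat \<Rightarrow> 'a)"

definition sample_space :: "'a::topological_space sample measure" where
  "sample_space = count_space UNIV \<Otimes>\<^sub>M (\<Pi>\<^sub>M i\<in>UNIV. borel)"

definition sample_config :: "'a sample \<Rightarrow> (nat, 'a) config" where
  "sample_config s = ({i. enat i < fst s}, snd s)"

abbreviation sample_count :: "'a::topological_space sample \<Rightarrow> 'a set \<Rightarrow> ennreal" where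
  "sample_count s B \<equiv> emeasure (dirac_sum (sample_config s)) B"

definition radon_measure :: "'a::topological_space measure \<Rightarrow> bool" where
  "radon_measure \<mu> \<longleftrightarrow> sets \<mu> = sets borel \<and> (\<forall>K. compact K \<longrightarrow> emeasure \<mu> K < \<infinity>)"

definition poisson_process ::
  "'w measure \<Rightarrow> 'a::topological_space measure \<Rightarrow> ('w \<Rightarrow> 'a sample) \<Rightarrow> bool" where
  "poisson_process M \<mu> N \<longleftrightarrow>
     N \<in> M \<rightarrow>\<^sub>M sample_space \<and>
     (\<forall>B\<in>sets borel. emeasure \<mu> B < \<infinity> \<longrightarrow>
        (\<forall>k. measure M {\<omega> \<in> space M. sample_count (N \<omega>) B = of_nat k} =
               measure \<mu> B ^ k / fact k * exp (- measure \<mu> B))) \<and>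
     (\<forall>B :: nat \<Rightarrow> 'a set. range B \<subseteq> sets borel \<longrightarrow> disjoint_family B \<longrightarrow>
        prob_space.indep_vars M (\<lambda>_. borel) (\<lambda>j \<omega>. sample_count (N \<omega>) (B j)) UNIV)"

section \<open>Branching clusters\<close>

text \<open>
  Individuals carry Ulam-Harris labels, most recent generation first: \<open>[]\<close> is the ancestor and
  \<open>i # u\<close> is the \<open>i\<close>-th child of \<open>u\<close>. The argument \<open>s u\<close> is the offspring sample of \<open>u\<close>, relative
  to the position of \<open>u\<close>; it is given for every label but used only if \<open>u\<close> is born.
\<close>

primrec born :: "(nat list \<Rightarrow> 'a sample) \<Rightarrow> nat list \<Rightarrow> bool" where
  "born s [] \<longleftrightarrow> True"
| "born s (i # u) \<longleftrightarrow> born s u \<and> i \<in> fst (sample_config (s u))"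

primrec displacement :: "(nat list \<Rightarrow> 'a::real_vector sample) \<Rightarrow> nat list \<Rightarrow> 'a" where
  "displacement s [] = 0"
| "displacement s (i # u) = displacement s u + snd (sample_config (s u)) i"

definition descendants :: "(nat list \<Rightarrow> 'a::real_vector sample) \<Rightarrow> (nat list, 'a) config" where
  "descendants s = ({u. born s u \<and> u \<noteq> []}, displacement s)"

definition branching_process ::
  "'w measure \<Rightarrow> 'a::euclidean_space measure \<Rightarrow> ('w \<Rightarrow> nat list \<Rightarrow> 'a sample) \<Rightarrow> bool" where
  "branching_process M \<gamma> S \<longleftrightarrow>
     prob_space M \<and>
     (\<forall>u. poisson_process M \<gamma> (\<lambda>\<omega>. S \<omega> u)) \<and>
     prob_space.indep_vars M (\<lambda>_. sample_space) (\<lambda>u \<omega>. S \<omega> u) UNIV \<and>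
     (AE \<omega> in M. locally_finite_config (descendants (S \<omega>)))"

definition cluster_PGFl ::
  "'w measure \<Rightarrow> ('w \<Rightarrow> nat list \<Rightarrow> 'a::real_vector sample) \<Rightarrow> ('a \<Rightarrow> real) \<Rightarrow> 'a \<Rightarrow> real" where
  "cluster_PGFl M S f z = f z * (\<integral>\<omega>. config_prod (\<lambda>x. f (z + x)) (descendants (S \<omega>)) \<partial>M)"

section \<open>Hawkes processes\<close>

text \<open>Here \<open>s j u\<close> is the offspring sample of individual \<open>u\<close> in the cluster of the \<open>j\<close>-th immigrant.\<close>

definition hawkes_points ::
  "'a::real_vector sample \<Rightarrow> (nat \<Rightarrow> nat list \<Rightarrow> 'a sample) \<Rightarrow> (nat \<times> nat list, 'a) config" where
  "hawkes_points r s =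
     ({(j, u). j \<in> fst (sample_config r) \<and> born (s j) u},
      \<lambda>(j, u). snd (sample_config r) j + displacement (s j) u)"

definition hawkes_process ::
  "'w measure \<Rightarrow> 'a::euclidean_space measure \<Rightarrow> 'a measure \<Rightarrow>
   ('w \<Rightarrow> 'a sample) \<Rightarrow> ('w \<Rightarrow> nat \<Rightarrow> nat list \<Rightarrow> 'a sample) \<Rightarrow> bool" where
  "hawkes_process M \<gamma> \<nu> R S \<longleftrightarrow>
     prob_space M \<and>
     poisson_process M \<nu> R \<and>
     (\<forall>j u. poisson_process M \<gamma> (\<lambda>\<omega>. S \<omega> j u)) \<and>
     prob_space.indep_vars M (\<lambda>_. sample_space)
       (\<lambda>l \<omega>. case l of None \<Rightarrow> R \<omega> | Some (j, u) \<Rightarrow> S \<omega> j u) UNIV \<and>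
     (AE \<omega> in M. locally_finite_config (hawkes_points (R \<omega>) (S \<omega>)))"

definition hawkes_PGFl ::
  "'w measure \<Rightarrow> ('w \<Rightarrow> 'a::real_vector sample) \<Rightarrow> ('w \<Rightarrow> nat \<Rightarrow> nat list \<Rightarrow> 'a sample) \<Rightarrow>
   ('a \<Rightarrow> real) \<Rightarrow> real" where
  "hawkes_PGFl M R S f = (\<integral>\<omega>. config_prod f (hawkes_points (R \<omega>) (S \<omega>)) \<partial>M)"

end

theory Submission
  imports Defs
begin

text \<open>
  Given the first generation, the clusters of its members are independent, so the product over all
  points factorises and its conditional expectation is \<open>\<Prod> G x\<^sub>i\<close>; the generating functional of the
  Poisson process of the \<open>x\<^sub>i\<close> then turns this into an exponential. Two points need care.
  The expectation of an infinite product of independent factors of arbitrary sign is the product of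
  the expectations only because the product is defined almost surely (by Kolmogorov's law either
  all factors lie in \<open>[0, 1]\<close> or the product converges absolutely). And the subtrees need not have
  the law of the whole tree, since a Poisson process may be enumerated in any way; only their point
  processes agree. This is shown through Laplace functionals: a product with factors of arbitrary
  sign is a function of three products of \<open>[0, 1]\<close>-valued functions, whose joint moments the
  offspring intensity determines generation by generation.
\<close>

section \<open>Signed products as functions of sums\<close>

text \<open>Integrability is assumed for the product over all descendants, while nothing is assumed
  about finitely many generations. A recursion over generations for the signed product would
  therefore lack the expectations it speaks of. Products with factors in [0, 1] always have one,
  whence the detour through three of them. Their mixed moment with exponents a, b, c is again such a
  product: it belongs to the exponent a * \<open>neg_part_ln\<close> + b *
  \<open>pos_part_ln\<close> + c * \<open>neg_count\<close>. One recursion thus yields all moments,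
  and on the compact cube the moments determine the joint law. The signed product is a Borel
  function of the triple, so its integrability and its expectation pass together from one reference
  process to every subtree and every immigrant cluster. Both formulas are instances of
  \<open>hawkes_family_PGFl\<close>; in the recursion the first generation plays the part of the
  immigrants, with intensity \<gamma>.\<close>

lemma nn_integral_count_space_tendsto:
  fixes f :: "'i \<Rightarrow> ennreal"
  assumes "countable A"
  shows "((\<lambda>F. \<Sum>i\<in>F. f i) \<longlongrightarrow> (\<integral>\<^sup>+i. f i \<partial>count_space A)) (finite_subsets_at_top A)"
proof -
  define s where "s = (SUP F\<in>{F. finite F \<and> F \<subseteq> A}. \<Sum>i\<in>F. f i)"
  have s: "((\<lambda>F. \<Sum>i\<in>F. f i) \<longlongrightarrow> s) (finite_subsets_at_top A)"
    using nonneg_has_sum_complete[of A f] by (simp add: has_sum_def s_def)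
  have le: "(\<Sum>i\<in>F. f i) \<le> (\<integral>\<^sup>+i. f i \<partial>count_space A)" if "finite F" "F \<subseteq> A" for F
  proof -
    have "(\<Sum>i\<in>F. f i) = (\<integral>\<^sup>+i. f i \<partial>count_space F)"
      using that by (simp add: nn_integral_count_space_finite)
    also have "\<dots> = (\<integral>\<^sup>+i. f i * indicator F i \<partial>count_space A)"
      by (subst nn_integral_count_space_indicator[of F], simp,
          subst nn_integral_count_space_indicator[of A], simp)
         (use that in \<open>auto intro!: nn_integral_cong simp: indicator_def\<close>)
    also have "\<dots> \<le> (\<integral>\<^sup>+i. f i \<partial>count_space A)"
      by (intro nn_integral_mono) (auto simp: indicator_def)
    finally show ?thesis .
  qed
  have "(\<integral>\<^sup>+i. f i \<partial>count_space A) \<le> s"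
  proof (cases "finite A")
    case True
    then show ?thesis
      by (auto simp: nn_integral_count_space_finite s_def intro!: SUP_upper)
  next
    case False
    then have bij: "bij_betw (from_nat_into A) UNIV A"
      using assms by (intro bij_betw_from_nat_into)
    have "(\<integral>\<^sup>+i. f i \<partial>count_space A) = (\<Sum>n. f (from_nat_into A n))"
      using nn_integral_bij_count_space[OF bij, of f]
      by (simp add: nn_integral_count_space_nat)
    also have "\<dots> = (SUP n. \<Sum>i<n. f (from_nat_into A i))"
      by (rule suminf_eq_SUP)
    also have "\<dots> \<le> s"
    proof (rule SUP_least)
      fix n
      have inj: "inj_on (from_nat_into A) {..<n}"
        using bij by (auto simp: bij_betw_def intro: inj_on_subset)
      have "(\<Sum>i<n. f (from_nat_into A i)) = (\<Sum>i\<in>from_nat_into A ` {..<n}. f i)"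
        using inj by (simp add: sum.reindex)
      also have "\<dots> \<le> s"
        using bij unfolding s_def by (intro SUP_upper) (auto simp: bij_betw_def)
      finally show "(\<Sum>i<n. f (from_nat_into A i)) \<le> s" .
    qed
    finally show ?thesis .
  qed
  moreover have "s \<le> (\<integral>\<^sup>+i. f i \<partial>count_space A)"
    unfolding s_def using le by (intro SUP_least) auto
  ultimately have "s = (\<integral>\<^sup>+i. f i \<partial>count_space A)" by (rule antisym[rotated])
  with s show ?thesis by simp
qed

text \<open>The value at infinity is what a zero factor needs: it contributes \<open>\<top>\<close>
  to the sum of logarithms and so makes the product 0. A product with infinitely many factors in
  [0, 1] may vanish in the same way.\<close>

definition exp_neg :: "ennreal \<Rightarrow> real" where
  "exp_neg t = (if t = \<top> then 0 else exp (- enn2real t))"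

lemma exp_neg_simps [simp]: "exp_neg 0 = 1" "exp_neg \<top> = 0"
  by (auto simp: exp_neg_def)

lemma exp_neg_ennreal: "0 \<le> x \<Longrightarrow> exp_neg (ennreal x) = exp (- x)"
  by (simp add: exp_neg_def)

lemma exp_neg_nonneg [simp]: "0 \<le> exp_neg t"
  and exp_neg_le_1 [simp]: "exp_neg t \<le> 1"
  by (auto simp: exp_neg_def)

lemma exp_neg_eq_0_iff [simp]: "exp_neg t = 0 \<longleftrightarrow> t = \<top>"
  by (auto simp: exp_neg_def)

lemma exp_neg_add: "exp_neg (s + t) = exp_neg s * exp_neg t"
  by (cases s; cases t) (auto simp: exp_neg_def exp_add[symmetric] simp flip: ennreal_plus)

lemma exp_neg_sum: "exp_neg (\<Sum>i\<in>F. g i) = (\<Prod>i\<in>F. exp_neg (g i))"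
  by (induction F rule: infinite_finite_induct) (auto simp: exp_neg_add)

lemma exp_neg_of_nat_mult: "exp_neg (of_nat k * t) = exp_neg t ^ k"
  by (induction k) (auto simp: exp_neg_add algebra_simps)

lemma exp_neg_measurable [measurable]: "exp_neg \<in> borel_measurable borel"
  unfolding exp_neg_def by measurable

lemma tendsto_exp_neg:
  assumes "(X \<longlongrightarrow> t) F"
  shows "((\<lambda>x. exp_neg (X x)) \<longlongrightarrow> exp_neg t) F"
proof (cases "t = \<top>")
  case False
  then have fin: "\<forall>\<^sub>F x in F. X x \<noteq> \<top>"
    using assms by (auto intro!: tendsto_imp_eventually_ne)
  have "((\<lambda>x. enn2real (X x)) \<longlongrightarrow> enn2real t) F"
    using assms False
    by (intro tendsto_enn2real) (auto simp: less_top)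
  then have "((\<lambda>x. exp (- enn2real (X x))) \<longlongrightarrow> exp (- enn2real t)) F"
    by (intro tendsto_exp tendsto_minus)
  then show ?thesis
    using False by (auto simp: exp_neg_def elim!: tendsto_cong[THEN iffD1, rotated]
      intro: eventually_mono[OF fin])
next
  case True
  show ?thesis
    unfolding True exp_neg_simps
  proof (rule tendstoI)
    fix e :: real assume e: "0 < e"
    \<comment> \<open>Beyond -ln e the exponential is below e; the maximum with 0 makes the
      threshold a legitimate \<open>ennreal\<close>.\<close>
    define c where "c = max 0 (- ln e)"
    then have c0: "0 \<le> c" by simp
    have "ennreal c < t"
      using True by simp
    then have "\<forall>\<^sub>F x in F. ennreal c < X x"
      using assms by (rule order_tendstoD(1)[rotated])
    then show "\<forall>\<^sub>F x in F. dist (exp_neg (X x)) 0 < e"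
    proof eventually_elim
      case (elim x)
      show ?case
      proof (cases "X x")
        case (real y)
        with elim have "c < y" by (simp add: ennreal_less_iff c0)
        then have "- y < ln e" by (auto simp: c_def)
        then have "exp (- y) < exp (ln e)" by (simp only: exp_less_cancel_iff)
        then have "exp (- y) < e" using e by simp
        then show ?thesis using real by (simp add: exp_neg_ennreal)
      qed (use e in auto)
    qed
  qed
qed

text \<open>
  A real product is recovered from the three \<open>[0, 1]\<close>-valued products of \<open>min 1 \<bar>a\<bar>\<close>, of
  \<open>min 1 (1 / \<bar>a\<bar>)\<close>, and of \<open>1 / e\<close> over the negative factors.
\<close>

definition neg_part_ln :: "real \<Rightarrow> ennreal" where
  "neg_part_ln a = (if a = 0 then \<top> else ennreal (- ln \<bar>a\<bar>))"

text \<open>\<open>ennreal\<close> cuts negative reals off at 0, so factors of modulus below 1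
  contribute nothing here, just as factors of modulus above 1 contribute nothing to
  \<open>neg_part_ln\<close>.\<close>

definition pos_part_ln :: "real \<Rightarrow> ennreal" where
  "pos_part_ln a = ennreal (ln \<bar>a\<bar>)"

definition neg_count :: "real \<Rightarrow> ennreal" where
  "neg_count a = (if a < 0 then 1 else 0)"

text \<open>The quotient \<open>x / y\<close> is the modulus of the product. With n negative factors
  \<open>z\<close> is exp (-n), and the cosine is cos (pi n) = (-1)^n; this makes the sign, too, a
  Borel function of a number in [0, 1].\<close>

definition signed_of :: "real \<times> real \<times> real \<Rightarrow> real" where
  "signed_of = (\<lambda>(x, y, z). x / y * cos (pi * ln z))"

lemma neg_part_ln_measurable [measurable]: "neg_part_ln \<in> borel_measurable borel"
  unfolding neg_part_ln_def by measurable

lemma pos_part_ln_measurable [measurable]: "pos_part_ln \<in> borel_measurable borel"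
  unfolding pos_part_ln_def by measurable

lemma neg_count_measurable [measurable]: "neg_count \<in> borel_measurable borel"
  unfolding neg_count_def by measurable

lemma signed_of_measurable [measurable]: "signed_of \<in> borel_measurable borel"
proof -
  have "signed_of \<in> borel_measurable (borel \<Otimes>\<^sub>M (borel \<Otimes>\<^sub>M borel))"
    unfolding signed_of_def by measurable
  then show ?thesis by (simp add: borel_prod)
qed

definition sum_over :: "('a \<Rightarrow> ennreal) \<Rightarrow> ('i, 'a) config \<Rightarrow> ennreal" where
  "sum_over \<phi> \<xi> = (\<integral>\<^sup>+i. \<phi> (snd \<xi> i) \<partial>count_space (fst \<xi>))"

definition signed_prod :: "ennreal \<Rightarrow> ennreal \<Rightarrow> ennreal \<Rightarrow> real" where
  "signed_prod s t n = signed_of (exp_neg s, exp_neg t, exp_neg n)"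

lemma signed_prod_simps [simp]: "signed_prod 0 0 0 = 1"
  by (simp add: signed_prod_def signed_of_def)

lemma signed_prod_single:
  "signed_prod (neg_part_ln a) (pos_part_ln a) (neg_count a) = a"
proof (cases "a = 0")
  case False
  have "exp_neg (neg_part_ln a) / exp_neg (pos_part_ln a) = \<bar>a\<bar>"
  proof (cases "\<bar>a\<bar> \<le> 1")
    case True
    then have "ln \<bar>a\<bar> \<le> 0" using False by (simp add: ln_le_zero_iff)
    then show ?thesis using False
      by (simp add: neg_part_ln_def pos_part_ln_def exp_neg_ennreal ennreal_neg)
  next
    case gt: False
    then have "0 \<le> ln \<bar>a\<bar>" by simp
    then show ?thesis using False
      by (simp add: neg_part_ln_def pos_part_ln_def exp_neg_ennreal ennreal_neg exp_minus divide_inverse)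
  qed
  moreover have "cos (pi * ln (exp_neg (neg_count a))) = sgn a"
    using False exp_neg_ennreal[of 1] by (auto simp: neg_count_def sgn_real_def)
  ultimately show ?thesis
    using abs_mult_sgn[of a]
    by (simp add: signed_prod_def signed_of_def flip: times_divide_eq_left)
qed (simp add: signed_prod_def signed_of_def neg_part_ln_def)

text \<open>The sign is multiplicative because the sine terms in the addition theorem vanish at
  integer multiples of pi; for counts that are not natural numbers this would fail.\<close>

lemma signed_prod_add:
  assumes "n = of_nat k" "n' = of_nat k'"
  shows "signed_prod (s + s') (t + t') (n + n') = signed_prod s t n * signed_prod s' t' n'"
proof -
  have ln_of_nat: "ln (exp_neg (of_nat k)) = - real k" for k
    using exp_neg_ennreal[of "real k"] by (simp add: ennreal_of_nat_eq_real_of_nat)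
  have "cos (pi * ln (exp_neg (n + n'))) = cos (pi * ln (exp_neg n)) * cos (pi * ln (exp_neg n'))"
  proof -
    have "pi * (- real (k + k')) = - (pi * real k + pi * real k')"
      by (simp add: algebra_simps)
    then have "cos (pi * (- real (k + k'))) = cos (pi * (- real k)) * cos (pi * (- real k'))"
      by (simp only: cos_minus mult_minus_right cos_add) simp
    then show ?thesis
      using ln_of_nat[of "k + k'"] ln_of_nat[of k] ln_of_nat[of k'] assms by simp
  qed
  then show ?thesis
    by (simp add: signed_prod_def signed_of_def exp_neg_add)
qed

lemma neg_count_sum_nat: "\<exists>k::nat. (\<Sum>i\<in>F. neg_count (a i)) = of_nat k"
proof (induction F rule: infinite_finite_induct)
  case (insert i F)
  then obtain k where "(\<Sum>i\<in>F. neg_count (a i)) = of_nat k" by blast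
  then have "(\<Sum>i\<in>insert i F. neg_count (a i)) = of_nat (if a i < 0 then Suc k else k)"
    using insert by (simp add: neg_count_def)
  then show ?case by blast
qed (auto intro: exI[of _ 0])

lemma signed_prod_finite:
  "signed_prod (\<Sum>i\<in>F. neg_part_ln (a i)) (\<Sum>i\<in>F. pos_part_ln (a i)) (\<Sum>i\<in>F. neg_count (a i))
    = (\<Prod>i\<in>F. a i)"
proof (induction F rule: infinite_finite_induct)
  case (insert i F)
  obtain k where k: "(\<Sum>i\<in>F. neg_count (a i)) = of_nat k"
    using neg_count_sum_nat by blast
  have "neg_count (a i) = of_nat (if a i < 0 then 1 else 0)"
    by (simp add: neg_count_def)
  from signed_prod_add[OF this k] show ?case
    using insert by (simp add: signed_prod_single)
qed auto

text \<open>Finite limits \<open>t'\<close> and \<open>n'\<close> keep the denominator and the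
  argument of the logarithm away from 0. The limit \<open>s'\<close> may be infinite: the product
  then tends to 0.\<close>

lemma tendsto_signed_prod:
  assumes "(s \<longlongrightarrow> s') F" "(t \<longlongrightarrow> t') F" "(n \<longlongrightarrow> n') F" "t' \<noteq> \<top>" "n' \<noteq> \<top>"
  shows "((\<lambda>x. signed_prod (s x) (t x) (n x)) \<longlongrightarrow> signed_prod s' t' n') F"
  unfolding signed_prod_def signed_of_def prod.case
  by (intro tendsto_divide tendsto_mult isCont_tendsto_compose[OF isCont_cos] tendsto_ln tendsto_const tendsto_exp_neg assms)
    (use assms in auto)

section \<open>Signed products over configurations and their distance from 1\<close>

definition signed_config_prod :: "('a \<Rightarrow> real) \<Rightarrow> ('i, 'a) config \<Rightarrow> real" where
  "signed_config_prod f \<xi> =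
     signed_prod (sum_over (neg_part_ln \<circ> f) \<xi>) (sum_over (pos_part_ln \<circ> f) \<xi>)
       (sum_over (neg_count \<circ> f) \<xi>)"

definition deviation :: "('a \<Rightarrow> real) \<Rightarrow> 'a \<Rightarrow> ennreal" where
  "deviation f x = ennreal \<bar>f x - 1\<bar>"

lemma pos_part_ln_le: "pos_part_ln a \<le> ennreal \<bar>a - 1\<bar>"
proof (cases "a = 0")
  case False
  then have "ln \<bar>a\<bar> \<le> \<bar>a\<bar> - 1" by (intro ln_le_minus_one) auto
  also have "\<dots> \<le> \<bar>a - 1\<bar>" by auto
  finally show ?thesis unfolding pos_part_ln_def by (rule ennreal_leI)
qed (simp add: pos_part_ln_def)

lemma neg_count_le: "neg_count a \<le> ennreal \<bar>a - 1\<bar>"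
  by (auto simp: neg_count_def intro!: ennreal_leI simp flip: ennreal_1)

lemma config_prod_defined_cases:
  assumes "config_prod_defined f \<xi>" "countable (fst \<xi>)"
  shows "(\<forall>i\<in>fst \<xi>. 0 \<le> f (snd \<xi> i) \<and> f (snd \<xi> i) \<le> 1) \<or> sum_over (deviation f) \<xi> \<noteq> \<top>"
proof -
  have "sum_over (deviation f) \<xi> \<noteq> \<top>" if s: "(\<lambda>i. \<bar>f (snd \<xi> i) - 1\<bar>) summable_on fst \<xi>"
  proof -
    have "sum_over (deviation f) \<xi> \<le> ennreal (\<Sum>\<^sub>\<infinity>i\<in>fst \<xi>. \<bar>f (snd \<xi> i) - 1\<bar>)"
      unfolding sum_over_def
    proof (rule tendsto_upperbound[OF nn_integral_count_space_tendsto])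
      show "\<forall>\<^sub>F F in finite_subsets_at_top (fst \<xi>).
          (\<Sum>i\<in>F. deviation f (snd \<xi> i)) \<le> ennreal (\<Sum>\<^sub>\<infinity>i\<in>fst \<xi>. \<bar>f (snd \<xi> i) - 1\<bar>)"
        using s by (intro eventually_finite_subsets_at_top_weakI)
          (auto simp: deviation_def sum_ennreal intro!: ennreal_leI finite_sum_le_infsum)
    qed (use assms in auto)
    then show ?thesis by (auto simp: top_unique)
  qed
  then show ?thesis using assms by (auto simp: config_prod_defined_def)
qed

lemma sum_over_mono: "(\<And>x. \<phi> x \<le> \<psi> x) \<Longrightarrow> sum_over \<phi> \<xi> \<le> sum_over \<psi> \<xi>"
  unfolding sum_over_def by (intro nn_integral_mono) auto

lemma sum_over_eq_0: "(\<And>i. i \<in> fst \<xi> \<Longrightarrow> \<phi> (snd \<xi> i) = 0) \<Longrightarrow> sum_over \<phi> \<xi> = 0"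
  unfolding sum_over_def
  by (subst nn_integral_cong[where v = "\<lambda>_. 0"]) auto

lemma unit_interval_ln:
  assumes "0 \<le> a" "a \<le> 1"
  shows "pos_part_ln a = 0" "neg_count a = 0"
  using assms by (auto simp: pos_part_ln_def neg_count_def ennreal_neg ln_le_zero_iff le_less)

text \<open>Both sums vanish when all factors lie in [0, 1], and both are dominated by the sum of
  the deviations |f - 1| when the product converges absolutely. This is the finiteness under which
  \<open>signed_prod\<close> is continuous.\<close>

lemma config_prod_defined_finite:
  assumes "config_prod_defined f \<xi>" "countable (fst \<xi>)"
  shows "sum_over (pos_part_ln \<circ> f) \<xi> \<noteq> \<top>" "sum_over (neg_count \<circ> f) \<xi> \<noteq> \<top>"
proof -
  have "sum_over (pos_part_ln \<circ> f) \<xi> \<le> sum_over (deviation f) \<xi>"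
    "sum_over (neg_count \<circ> f) \<xi> \<le> sum_over (deviation f) \<xi>"
    by (auto intro!: sum_over_mono simp: deviation_def pos_part_ln_le neg_count_le)
  moreover have "sum_over (pos_part_ln \<circ> f) \<xi> = 0 \<and> sum_over (neg_count \<circ> f) \<xi> = 0"
    if "\<forall>i\<in>fst \<xi>. 0 \<le> f (snd \<xi> i) \<and> f (snd \<xi> i) \<le> 1"
    using that by (auto intro!: sum_over_eq_0 unit_interval_ln)
  ultimately show "sum_over (pos_part_ln \<circ> f) \<xi> \<noteq> \<top>" "sum_over (neg_count \<circ> f) \<xi> \<noteq> \<top>"
    using config_prod_defined_cases[OF assms] by (auto simp: top_unique)
qed

lemma tendsto_signed_config_prod:
  assumes "countable (fst \<xi>)"
    and "sum_over (pos_part_ln \<circ> f) \<xi> \<noteq> \<top>" "sum_over (neg_count \<circ> f) \<xi> \<noteq> \<top>"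
  shows "((\<lambda>F. \<Prod>i\<in>F. f (snd \<xi> i)) \<longlongrightarrow> signed_config_prod f \<xi>) (finite_subsets_at_top (fst \<xi>))"
proof -
  have "((\<lambda>F. signed_prod (\<Sum>i\<in>F. neg_part_ln (f (snd \<xi> i))) (\<Sum>i\<in>F. pos_part_ln (f (snd \<xi> i)))
      (\<Sum>i\<in>F. neg_count (f (snd \<xi> i)))) \<longlongrightarrow> signed_config_prod f \<xi>) (finite_subsets_at_top (fst \<xi>))"
    unfolding signed_config_prod_def
    using assms unfolding sum_over_def comp_def
    by (intro tendsto_signed_prod nn_integral_count_space_tendsto)
  then show ?thesis by (simp add: signed_prod_finite)
qed

text \<open>\<open>Lim\<close> picks the intended value only if the net of finite subproducts
  converges. It does, since every subproduct is a \<open>signed_prod\<close> of finite sums and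
  these sums converge.\<close>

lemma config_prod_eq_signed:
  assumes "config_prod_defined f \<xi>" "countable (fst \<xi>)"
  shows "config_prod f \<xi> = signed_config_prod f \<xi>"
  unfolding config_prod_def using assms
  by (intro tendsto_Lim tendsto_signed_config_prod config_prod_defined_finite) auto

lemma signed_config_prod_unit:
  assumes "\<And>i. i \<in> fst \<xi> \<Longrightarrow> 0 \<le> f (snd \<xi> i) \<and> f (snd \<xi> i) \<le> 1"
  shows "0 \<le> signed_config_prod f \<xi>" "signed_config_prod f \<xi> \<le> 1"
proof -
  have "sum_over (pos_part_ln \<circ> f) \<xi> = 0" "sum_over (neg_count \<circ> f) \<xi> = 0"
    using assms by (auto intro!: sum_over_eq_0 unit_interval_ln)
  then have "signed_config_prod f \<xi> = exp_neg (sum_over (neg_part_ln \<circ> f) \<xi>)"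
    by (simp add: signed_config_prod_def signed_prod_def signed_of_def)
  then show "0 \<le> signed_config_prod f \<xi>" "signed_config_prod f \<xi> \<le> 1" by simp_all
qed

text \<open>Write a p - 1 = a (p - 1) + (a - 1) and use |a| \<le> 1 + |a - 1| \<le> exp |a - 1|; the
  right-hand side then telescopes.\<close>

lemma abs_prod_minus_1_le_exp:
  fixes a :: "'i \<Rightarrow> real"
  shows "\<bar>(\<Prod>i\<in>F. a i) - 1\<bar> \<le> exp (\<Sum>i\<in>F. \<bar>a i - 1\<bar>) - 1"
proof (induction F rule: infinite_finite_induct)
  case (insert i F)
  let ?p = "\<Prod>i\<in>F. a i" and ?s = "\<Sum>i\<in>F. \<bar>a i - 1\<bar>" and ?d = "\<bar>a i - 1\<bar>"
  have d: "1 + ?d \<le> exp ?d" by (rule exp_ge_add_one_self)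
  have "\<bar>a i * ?p - 1\<bar> = \<bar>a i * (?p - 1) + (a i - 1)\<bar>" by (simp add: algebra_simps)
  also have "\<dots> \<le> \<bar>a i\<bar> * \<bar>?p - 1\<bar> + ?d"
    by (rule order_trans[OF abs_triangle_ineq]) (simp add: abs_mult)
  also have "\<dots> \<le> exp ?d * (exp ?s - 1) + (exp ?d - 1)"
    using insert.IH d by (intro add_mono mult_mono) ((linarith | simp)+)
  also have "\<dots> = exp (?d + ?s) - 1" by (simp add: exp_add algebra_simps)
  finally show ?case using insert by simp
qed auto

text \<open>Limit of the finite estimate along finite subsets. It controls the weight of a cluster
  by its total deviation, a quantity that adds up over clusters.\<close>

lemma signed_config_prod_deviation:
  assumes c: "countable (fst \<xi>)" and h: "sum_over (deviation f) \<xi> \<noteq> \<top>"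
  shows "\<bar>signed_config_prod f \<xi> - 1\<bar> \<le> exp (enn2real (sum_over (deviation f) \<xi>)) - 1"
proof -
  have "sum_over (pos_part_ln \<circ> f) \<xi> \<le> sum_over (deviation f) \<xi>"
    "sum_over (neg_count \<circ> f) \<xi> \<le> sum_over (deviation f) \<xi>"
    by (auto intro!: sum_over_mono simp: deviation_def pos_part_ln_le neg_count_le)
  then have lim: "((\<lambda>F. \<Prod>i\<in>F. f (snd \<xi> i)) \<longlongrightarrow> signed_config_prod f \<xi>) (finite_subsets_at_top (fst \<xi>))"
    using c h by (intro tendsto_signed_config_prod) (auto simp: top_unique)
  have lim2: "((\<lambda>F. \<Sum>i\<in>F. deviation f (snd \<xi> i)) \<longlongrightarrow> sum_over (deviation f) \<xi>)
      (finite_subsets_at_top (fst \<xi>))"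
    unfolding sum_over_def by (rule nn_integral_count_space_tendsto[OF c])
  have "((\<lambda>F. enn2real (\<Sum>i\<in>F. deviation f (snd \<xi> i))) \<longlongrightarrow> enn2real (sum_over (deviation f) \<xi>))
      (finite_subsets_at_top (fst \<xi>))"
    by (rule tendsto_enn2real) (use lim2 h in \<open>auto simp: less_top\<close>)
  then have "((\<lambda>F. \<Sum>i\<in>F. \<bar>f (snd \<xi> i) - 1\<bar>) \<longlongrightarrow> enn2real (sum_over (deviation f) \<xi>))
      (finite_subsets_at_top (fst \<xi>))"
    by (simp add: deviation_def sum_ennreal sum_nonneg)
  then have "((\<lambda>F. exp (\<Sum>i\<in>F. \<bar>f (snd \<xi> i) - 1\<bar>) - 1) \<longlongrightarrow>
      exp (enn2real (sum_over (deviation f) \<xi>)) - 1) (finite_subsets_at_top (fst \<xi>))"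
    by (intro tendsto_intros)
  moreover have "((\<lambda>F. \<bar>(\<Prod>i\<in>F. f (snd \<xi> i)) - 1\<bar>) \<longlongrightarrow> \<bar>signed_config_prod f \<xi> - 1\<bar>)
      (finite_subsets_at_top (fst \<xi>))"
    using lim by (intro tendsto_intros)
  ultimately show ?thesis
    by (rule tendsto_le[OF finite_subsets_at_top_neq_bot])
      (intro always_eventually allI abs_prod_minus_1_le_exp)
qed

section \<open>The moment problem on the unit cube\<close>

text \<open>Closed sets form an intersection-stable generator of the Borel sets, and the indicator
  of a nonempty closed C is the limit of the continuous functions max 0 (1 - n dist(x, C)).\<close>

lemma measure_eqI_bounded_continuous:
  fixes M N :: "'a::metric_space measure"
  assumes "prob_space M" "prob_space N" "sets M = sets borel" "sets N = sets borel"
    and eq: "\<And>f::'a \<Rightarrow> real. continuous_on UNIV f \<Longrightarrow> (\<And>x. f x \<in> {0..1}) \<Longrightarrow>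
      (\<integral>x. f x \<partial>M) = (\<integral>x. f x \<partial>N)"
  shows "M = N"
proof (rule measure_eqI_generator_eq[where E = "Collect closed" and \<Omega> = UNIV and A = "\<lambda>_. UNIV"])
  interpret M: prob_space M by fact
  interpret N: prob_space N by fact
  show "Int_stable (Collect closed :: 'a set set)"
    by (auto simp: Int_stable_def)
  show "sets M = sigma_sets UNIV (Collect closed)" "sets N = sigma_sets UNIV (Collect closed)"
    using assms(3,4) by (simp_all add: borel_eq_closed)
  show "emeasure M C = emeasure N C" if "C \<in> Collect closed" for C
  \<comment> \<open>\<open>infdist x {}\<close> is 0 by convention, so for the empty set the
    functions below would be constantly 1.\<close>
  proof (cases "C = {}")
    case False
    define g where "g n x = max 0 (1 - real n * infdist x C)" for n and x :: 'a
    have cont: "continuous_on UNIV (g n)" for n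
      unfolding g_def by (intro continuous_intros)
    have g01: "g n x \<in> {0..1}" for n x
      by (auto simp: g_def infdist_nonneg)
    have lim: "(\<lambda>n. g n x) \<longlonglongrightarrow> indicator C x" for x
    proof (cases "x \<in> C")
      case True
      then show ?thesis by (simp add: g_def)
    next
      case notin: False
      then have pos: "0 < infdist x C"
        using that False by (simp add: infdist_pos_not_in_closed)
      obtain n0 :: nat where "1 / infdist x C < n0" using reals_Archimedean2 by blast
      then have n0: "1 < real n0 * infdist x C"
        using pos by (simp add: field_simps)
      have "g n x = 0" if "n0 \<le> n" for n
      proof -
        have "real n0 * infdist x C \<le> real n * infdist x C"
          using that pos by (intro mult_right_mono) auto
        then show ?thesis using n0 by (simp add: g_def)
      qed
      then have "\<forall>\<^sub>F n in sequentially. g n x = 0"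
        by (rule eventually_sequentiallyI)
      then show ?thesis using notin by (simp add: tendsto_eventually)
    qed
    have conv: "(\<lambda>n. \<integral>x. g n x \<partial>K) \<longlonglongrightarrow> measure K C" if "prob_space K" "sets K = sets borel" for K
    proof -
      interpret K: prob_space K by fact
      have [measurable]: "C \<in> sets K" "\<And>n. g n \<in> borel_measurable K"
        using \<open>C \<in> Collect closed\<close> cont that(2)
        by (auto simp: measurable_cong_sets[OF that(2) refl] intro: borel_measurable_continuous_onI)
      have "(\<lambda>n. \<integral>x. g n x \<partial>K) \<longlonglongrightarrow> (\<integral>x. indicator C x \<partial>K)"
        by (rule integral_dominated_convergence[where w = "\<lambda>_. 1"]) (use lim g01 in auto)
      then show ?thesis by (simp add: Int_absorb2 sets.sets_into_space)
    qed
    have "measure M C = measure N C"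
      using conv[of M] conv[of N] assms(1-4) eq[OF cont g01] by (intro LIMSEQ_unique) auto
    then show ?thesis by (simp add: M.emeasure_eq_measure N.emeasure_eq_measure)
  qed simp
  show "emeasure M UNIV \<noteq> \<infinity>" using M.emeasure_finite by auto
qed auto

text \<open>Built by linear operations alone, since equality of integrals is inherited by linear
  combinations but not by products.\<close>

inductive_set monomial_span :: "(real \<times> real \<times> real \<Rightarrow> real) set" where
  monomial: "(\<lambda>(x, y, z). x ^ a * y ^ b * z ^ c) \<in> monomial_span"
| add: "f \<in> monomial_span \<Longrightarrow> g \<in> monomial_span \<Longrightarrow> (\<lambda>p. f p + g p) \<in> monomial_span"
| scale: "f \<in> monomial_span \<Longrightarrow> (\<lambda>p. r * f p) \<in> monomial_span"

lemma monomial_span_coordinate: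
  assumes "f \<in> monomial_span"
  shows "(\<lambda>p. fst p * f p) \<in> monomial_span \<and> (\<lambda>p. fst (snd p) * f p) \<in> monomial_span \<and>
    (\<lambda>p. snd (snd p) * f p) \<in> monomial_span"
  using assms
proof induction
  case (monomial a b c)
  show ?case
    using monomial_span.monomial[of "Suc a" b c] monomial_span.monomial[of a "Suc b" c]
      monomial_span.monomial[of a b "Suc c"]
    by (simp add: case_prod_unfold mult.assoc mult.left_commute)
next
  case (add f g)
  then show ?case
    unfolding distrib_left by (auto intro: monomial_span.add)
next
  case (scale f r)
  then show ?case
    unfolding mult.left_commute[of _ r] by (auto intro: monomial_span.scale)
qed

text \<open>The additional factor \<open>f\<close> carries the induction through products, as (p q)
  f = p (q f). A linear functional is a combination of the three coordinates. The case f = 1 puts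
  every polynomial into the span.\<close>

lemma real_polynomial_function_monomial_span:
  assumes "real_polynomial_function p" "f \<in> monomial_span"
  shows "(\<lambda>x. p x * f x) \<in> monomial_span"
  using assms
proof (induction arbitrary: f)
  case (linear l)
  interpret bounded_linear l by fact
  define \<alpha> \<beta> \<gamma> where "\<alpha> = l (1, 0, 0)" and "\<beta> = l (0, 1, 0)" and "\<gamma> = l (0, 0, 1)"
  have "l p = l (1, 0, 0) * fst p + l (0, 1, 0) * fst (snd p) + l (0, 0, 1) * snd (snd p)" for p
  proof -
    have "p = fst p *\<^sub>R (1, 0, 0) + fst (snd p) *\<^sub>R (0, 1, 0) + snd (snd p) *\<^sub>R (0, 0, 1)"
      by (simp add: prod_eq_iff)
    then have "l p = l (fst p *\<^sub>R (1, 0, 0) + fst (snd p) *\<^sub>R (0, 1, 0) + snd (snd p) *\<^sub>R (0, 0, 1))"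
      by (rule arg_cong)
    also have "\<dots> = l (1, 0, 0) * fst p + l (0, 1, 0) * fst (snd p) + l (0, 0, 1) * snd (snd p)"
      by (simp only: add scale) simp
    finally show ?thesis .
  qed
  then have "l p = \<alpha> * fst p + \<beta> * fst (snd p) + \<gamma> * snd (snd p)" for p
    unfolding \<alpha>_def \<beta>_def \<gamma>_def .
  then have eq: "(\<lambda>p. l p * f p) = (\<lambda>p. \<alpha> * (fst p * f p) + \<beta> * (fst (snd p) * f p) +
      \<gamma> * (snd (snd p) * f p))"
    by (auto simp: algebra_simps)
  note c = monomial_span_coordinate[OF linear.prems, THEN conjunct1]
    monomial_span_coordinate[OF linear.prems, THEN conjunct2, THEN conjunct1]
    monomial_span_coordinate[OF linear.prems, THEN conjunct2, THEN conjunct2]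
  show ?case
    unfolding eq
    by (rule monomial_span.add[OF monomial_span.add[OF
          monomial_span.scale[OF c(1), of \<alpha>] monomial_span.scale[OF c(2), of \<beta>]]
          monomial_span.scale[OF c(3), of \<gamma>]])
next
  case (const c)
  from monomial_span.scale[OF const.prems, of c] show ?case .
next
  case (add p q)
  from monomial_span.add[OF add.IH(1)[OF add.prems] add.IH(2)[OF add.prems]]
  show ?case by (simp only: distrib_right)
next
  case (mult p q)
  from mult.IH(1)[OF mult.IH(2)[OF mult.prems]]
  show ?case by (simp only: mult.assoc)
qed

text \<open>Both measures live on a compact cube, where polynomials approximate continuous functions
  uniformly by Stone-Weierstrass; equal moments mean equal integrals of polynomials.\<close>

lemma measure_eqI_moments:
  fixes M N :: "(real \<times> real \<times> real) measure"
  defines "K \<equiv> {0..1} \<times> {0..1} \<times> {0..1}"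
  assumes M: "prob_space M" "sets M = sets borel" "AE p in M. p \<in> K"
    and N: "prob_space N" "sets N = sets borel" "AE p in N. p \<in> K"
    and moments: "\<And>a b c. (\<integral>(x, y, z). x ^ a * y ^ b * z ^ c \<partial>M) = (\<integral>(x, y, z). x ^ a * y ^ b * z ^ c \<partial>N)"
  shows "M = N"
proof (rule measure_eqI_bounded_continuous)
  interpret M: prob_space M by fact
  interpret N: prob_space N by fact
  have cK: "compact K" unfolding K_def by (intro compact_Times compact_Icc)
  have int: "integrable L f" if "prob_space L" "sets L = sets borel" "AE p in L. p \<in> K"
    "continuous_on UNIV f" for f :: "real \<times> real \<times> real \<Rightarrow> real" and L
  proof -
    interpret L: prob_space L by fact
    have "compact (f ` K)"
      using that(4) cK by (intro compact_continuous_image) (auto intro: continuous_on_subset)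
    then obtain B where "\<And>x. x \<in> f ` K \<Longrightarrow> norm x \<le> B"
      by (meson bounded_iff compact_imp_bounded)
    then show ?thesis
      using that(3,4)
      by (intro L.integrable_const_bound[of _ B])
        (auto simp: measurable_cong_sets[OF that(2) refl] intro: borel_measurable_continuous_onI)
  qed
  have span: "continuous_on UNIV f \<and> (\<integral>p. f p \<partial>M) = (\<integral>p. f p \<partial>N)" if "f \<in> monomial_span" for f
    using that
  proof induction
    case (monomial a b c)
    then show ?case using moments[of a b c] by (auto simp: case_prod_unfold intro!: continuous_intros)
  next
    case (add f g)
    then show ?case using int[OF M] int[OF N] by (auto intro!: continuous_intros)
  next
    case (scale f r)
    then show ?case by (auto intro!: continuous_intros)
  qed
  fix f :: "real \<times> real \<times> real \<Rightarrow> real"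
  assume f: "continuous_on UNIV f"
  show "(\<integral>x. f x \<partial>M) = (\<integral>x. f x \<partial>N)"
  proof (rule ccontr)
    assume "(\<integral>x. f x \<partial>M) \<noteq> (\<integral>x. f x \<partial>N)"
    \<comment> \<open>A third of the gap: replacing the function by a polynomial costs at most
      \<open>e\<close> under each of the two measures, together less than the gap.\<close>
    then obtain e where e: "0 < e" "\<bar>(\<integral>x. f x \<partial>M) - (\<integral>x. f x \<partial>N)\<bar> > 2 * e"
      by (intro that[of "\<bar>(\<integral>x. f x \<partial>M) - (\<integral>x. f x \<partial>N)\<bar> / 3"]) auto
    obtain g where g: "real_polynomial_function g" "\<And>x. x \<in> K \<Longrightarrow> \<bar>f x - g x\<bar> < e"
      using Stone_Weierstrass_real_polynomial_function[OF cK continuous_on_subset[OF f] e(1)] by blast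
    have "(\<lambda>p. g p * 1) \<in> monomial_span"
      using real_polynomial_function_monomial_span[OF g(1) monomial_span.monomial[of 0 0 0]]
      by (simp add: case_prod_unfold)
    then have gs: "continuous_on UNIV g" "(\<integral>p. g p \<partial>M) = (\<integral>p. g p \<partial>N)" using span by auto
    have close: "\<bar>(\<integral>x. f x \<partial>L) - (\<integral>x. g x \<partial>L)\<bar> \<le> e"
      if L: "prob_space L" "sets L = sets borel" "AE p in L. p \<in> K" for L
    proof -
      interpret L: prob_space L by fact
      have "\<bar>(\<integral>x. f x \<partial>L) - (\<integral>x. g x \<partial>L)\<bar> = \<bar>\<integral>x. f x - g x \<partial>L\<bar>"
        using int[OF L] f gs by simp
      also have "\<dots> \<le> (\<integral>x. \<bar>f x - g x\<bar> \<partial>L)" by (rule integral_abs_bound)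
      also have "\<dots> \<le> (\<integral>x. e \<partial>L)"
      proof (rule integral_mono_AE)
        show "integrable L (\<lambda>x. \<bar>f x - g x\<bar>)"
          using f gs by (intro int[OF L] continuous_intros)
        show "AE x in L. \<bar>f x - g x\<bar> \<le> e"
          using L(3) by eventually_elim (rule less_imp_le[OF g(2)])
      qed simp
      finally show ?thesis by (simp add: L.prob_space)
    qed
    show False using close[OF M] close[OF N] gs(2) e(2) by linarith
  qed
qed (use M N in auto)

section \<open>Sequential infinite products\<close>

text \<open>In contrast to the limit along all finite subsets in \<open>config_prod\<close>, this is
  a limit along a sequence and therefore measurable in parameters.\<close>

definition seq_prod :: "(nat \<Rightarrow> real) \<Rightarrow> real" where
  "seq_prod a = lim (\<lambda>n. \<Prod>i<n. a i)"

lemma seq_prod_eqI: "(\<lambda>n. \<Prod>i<n. a i) \<longlonglongrightarrow> p \<Longrightarrow> seq_prod a = p"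
  unfolding seq_prod_def by (rule limI)

lemma seq_prod_LIMSEQ:
  fixes a :: "nat \<Rightarrow> real"
  assumes "summable (\<lambda>i. \<bar>a i - 1\<bar>)"
  shows "(\<lambda>n. \<Prod>i<n. a i) \<longlonglongrightarrow> seq_prod a"
proof -
  have "convergent_prod a"
    using assms by (intro abs_convergent_prod_imp_convergent_prod summable_imp_abs_convergent_prod) simp
  then have "convergent (\<lambda>n. \<Prod>i\<le>n. a i)"
    by (rule convergent_prod_imp_convergent)
  then obtain p where "(\<lambda>n. prod a {..n}) \<longlonglongrightarrow> p" by (auto simp: convergent_def)
  then have "(\<lambda>n. \<Prod>i<n. a i) \<longlonglongrightarrow> p" by (simp only: LIMSEQ_lessThan_iff_atMost)
  then show ?thesis using seq_prod_eqI by metis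
qed

lemma seq_prod_LIMSEQ_unit:
  fixes a :: "nat \<Rightarrow> real"
  assumes "\<And>i. 0 \<le> a i \<and> a i \<le> 1"
  shows "(\<lambda>n. \<Prod>i<n. a i) \<longlonglongrightarrow> seq_prod a"
proof -
  have "decseq (\<lambda>n. \<Prod>i<n. a i)"
    using assms by (intro decseq_SucI) (simp add: mult_left_le prod_nonneg)
  moreover have "Bseq (\<lambda>n. \<Prod>i<n. a i)"
    using assms by (intro BseqI'[of _ 1]) (auto simp: abs_prod intro!: prod_le_1)
  ultimately have "convergent (\<lambda>n. \<Prod>i<n. a i)"
    by (intro Bseq_monoseq_convergent) (auto simp: monoseq_iff)
  then show ?thesis unfolding seq_prod_def by (simp add: convergent_LIMSEQ_iff)
qed

lemma seq_prod_deviation: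
  fixes a :: "nat \<Rightarrow> real"
  assumes "summable (\<lambda>i. \<bar>a i - 1\<bar>)"
  shows "\<bar>seq_prod a - 1\<bar> \<le> exp (\<Sum>i. \<bar>a i - 1\<bar>) - 1"
proof (rule LIMSEQ_le_const2)
  show "(\<lambda>n. \<bar>(\<Prod>i<n. a i) - 1\<bar>) \<longlonglongrightarrow> \<bar>seq_prod a - 1\<bar>"
    using seq_prod_LIMSEQ[OF assms] by (intro tendsto_intros)
  have "\<bar>(\<Prod>i<n. a i) - 1\<bar> \<le> exp (\<Sum>i. \<bar>a i - 1\<bar>) - 1" for n
  proof -
    have "(\<Sum>i<n. \<bar>a i - 1\<bar>) \<le> (\<Sum>i. \<bar>a i - 1\<bar>)"
      using assms by (intro sum_le_suminf) auto
    then show ?thesis using abs_prod_minus_1_le_exp[of a "{..<n}"] by (smt (verit) exp_le_cancel_iff)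
  qed
  then show "\<exists>N. \<forall>n\<ge>N. \<bar>(\<Prod>i<n. a i) - 1\<bar> \<le> exp (\<Sum>i. \<bar>a i - 1\<bar>) - 1" by blast
qed

lemma prod_lessThan_shift:
  fixes a :: "nat \<Rightarrow> real"
  shows   "(\<Prod>i<n + m. a i) = (\<Prod>i<m. a i) * (\<Prod>i<n. a (i + m))"
  by (induction n) (simp_all add: algebra_simps)

lemma seq_prod_split:
  fixes a :: "nat \<Rightarrow> real"
  assumes "summable (\<lambda>i. \<bar>a i - 1\<bar>)"
  shows "seq_prod a = (\<Prod>i<m. a i) * seq_prod (\<lambda>i. a (i + m))"
proof -
  have "summable (\<lambda>i. \<bar>a (i + m) - 1\<bar>)"
    using assms by (simp add: summable_iff_shift[of "\<lambda>i. \<bar>a i - 1\<bar>"])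
  then have "(\<lambda>n. (\<Prod>i<m. a i) * (\<Prod>i<n. a (i + m))) \<longlonglongrightarrow> (\<Prod>i<m. a i) * seq_prod (\<lambda>i. a (i + m))"
    by (intro tendsto_intros seq_prod_LIMSEQ)
  then have "(\<lambda>n. \<Prod>i<n. a i) \<longlonglongrightarrow> (\<Prod>i<m. a i) * seq_prod (\<lambda>i. a (i + m))"
    unfolding prod_lessThan_shift[symmetric] by (rule LIMSEQ_offset)
  then show ?thesis by (rule seq_prod_eqI)
qed

text \<open>The distance from 1 is at most exp of the tail sum, minus 1. Consequently the tail
  product eventually stays in any neighbourhood of 1 and cannot vanish.\<close>

lemma seq_prod_tail_tendsto_1:
  fixes a :: "nat \<Rightarrow> real"
  assumes "summable (\<lambda>i. \<bar>a i - 1\<bar>)"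
  shows "(\<lambda>m. seq_prod (\<lambda>i. a (i + m))) \<longlonglongrightarrow> 1"
proof -
  have sm: "summable (\<lambda>i. \<bar>a (i + m) - 1\<bar>)" for m
    using assms by (simp add: summable_iff_shift[of "\<lambda>i. \<bar>a i - 1\<bar>"])
  have "(\<lambda>m. exp (\<Sum>i. \<bar>a (i + m) - 1\<bar>) - 1) \<longlonglongrightarrow> exp 0 - 1"
    by (rule tendsto_diff[OF tendsto_exp[OF suminf_exist_split2[OF assms]] tendsto_const])
  then have lim: "(\<lambda>m. exp (\<Sum>i. \<bar>a (i + m) - 1\<bar>) - 1) \<longlonglongrightarrow> 0" by simp
  have "(\<lambda>m. \<bar>seq_prod (\<lambda>i. a (i + m)) - 1\<bar>) \<longlonglongrightarrow> 0"
    by (rule tendsto_sandwich[OF _ _ tendsto_const lim])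
      (auto intro!: always_eventually seq_prod_deviation[OF sm])
  then have "(\<lambda>m. seq_prod (\<lambda>i. a (i + m)) - 1) \<longlonglongrightarrow> 0" by (simp only: tendsto_rabs_zero_iff)
  then show ?thesis by (rule LIM_zero_cancel)
qed

lemma prod_abs_le_exp:
  fixes a :: "'i \<Rightarrow> real"
  shows "\<bar>\<Prod>i\<in>F. a i\<bar> \<le> exp (\<Sum>i\<in>F. \<bar>a i - 1\<bar>)"
  using abs_prod_minus_1_le_exp[of a F] by linarith

text \<open>Tannery's theorem for products. Cutting the product after k factors costs at most C (exp
  (\<Sum>i. c (i + k)) - 1), uniformly in m, so the limit may be taken in finitely many
  factors.\<close>

lemma seq_prod_tannery:
  fixes a :: "nat \<Rightarrow> nat \<Rightarrow> real"
  assumes lim: "\<And>i. (\<lambda>m. a m i) \<longlonglongrightarrow> b i"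
    and bound: "\<And>m i. \<bar>a m i - 1\<bar> \<le> c i" and c: "summable c"
  shows "(\<lambda>m. seq_prod (a m)) \<longlonglongrightarrow> seq_prod b" and "summable (\<lambda>i. \<bar>b i - 1\<bar>)"
proof -
  have sa: "summable (\<lambda>i. \<bar>a m i - 1\<bar>)" for m
    using bound by (intro summable_comparison_test'[OF c, of 0]) auto
  have bb: "\<bar>b i - 1\<bar> \<le> c i" for i
    using lim[of i] bound by (intro LIMSEQ_le_const2[of "\<lambda>m. \<bar>a m i - 1\<bar>"]) (auto intro!: tendsto_intros)
  then show sb: "summable (\<lambda>i. \<bar>b i - 1\<bar>)"
    by (intro summable_comparison_test'[OF c, of 0]) auto
  \<comment> \<open>A common bound for all partial products whose deviations are majorised by
    \<open>c\<close>.\<close>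
  define C where "C = exp (suminf c)"
  have c0: "0 \<le> c i" for i using bound[of 0 i] by (rule order_trans[rotated]) simp
  have approx: "\<bar>seq_prod x - (\<Prod>i<k. x i)\<bar> \<le> C * (exp (\<Sum>i. c (i + k)) - 1)"
    if x: "\<And>i. \<bar>x i - 1\<bar> \<le> c i" for x k
  proof -
    have sx: "summable (\<lambda>i. \<bar>x i - 1\<bar>)"
      using x by (intro summable_comparison_test'[OF c, of 0]) auto
    then have sxk: "summable (\<lambda>i. \<bar>x (i + k) - 1\<bar>)"
      by (simp add: summable_iff_shift[of "\<lambda>i. \<bar>x i - 1\<bar>"])
    have "\<bar>seq_prod x - (\<Prod>i<k. x i)\<bar> = \<bar>\<Prod>i<k. x i\<bar> * \<bar>seq_prod (\<lambda>i. x (i + k)) - 1\<bar>"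
      by (subst seq_prod_split[OF sx, of k]) (simp add: abs_mult[symmetric] algebra_simps)
    also have "\<dots> \<le> C * (exp (\<Sum>i. c (i + k)) - 1)"
    proof (rule mult_mono)
      have "(\<Sum>i<k. \<bar>x i - 1\<bar>) \<le> (\<Sum>i<k. c i)" using x by (intro sum_mono)
      also have "\<dots> \<le> suminf c" using c c0 by (intro sum_le_suminf) auto
      finally show "\<bar>\<Prod>i<k. x i\<bar> \<le> C"
        unfolding C_def using prod_abs_le_exp[of x "{..<k}"] by (smt (verit) exp_le_cancel_iff)
      have "(\<Sum>i. \<bar>x (i + k) - 1\<bar>) \<le> (\<Sum>i. c (i + k))"
        using x sxk c by (intro suminf_le) (auto simp: summable_iff_shift)
      then show "\<bar>seq_prod (\<lambda>i. x (i + k)) - 1\<bar> \<le> exp (\<Sum>i. c (i + k)) - 1"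
        using seq_prod_deviation[OF sxk] by (smt (verit) exp_le_cancel_iff)
    qed (auto simp: C_def)
    finally show ?thesis .
  qed
  have "(\<lambda>k. C * (exp (\<Sum>i. c (i + k)) - 1)) \<longlonglongrightarrow> C * (exp 0 - 1)"
    by (intro tendsto_mult tendsto_diff tendsto_exp tendsto_const suminf_exist_split2[OF c])
  then have small: "(\<lambda>k. C * (exp (\<Sum>i. c (i + k)) - 1)) \<longlonglongrightarrow> 0" by simp
  show "(\<lambda>m. seq_prod (a m)) \<longlonglongrightarrow> seq_prod b"
  proof (rule LIMSEQ_I)
    fix e :: real assume e: "0 < e"
    \<comment> \<open>One third each for the two truncation errors and for the difference of the
      finite products.\<close>
    obtain k where k: "C * (exp (\<Sum>i. c (i + k)) - 1) < e / 3"
      using order_tendstoD(2)[OF small, of "e / 3"] e by (auto simp: eventually_sequentially)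
    have "(\<lambda>m. \<Prod>i<k. a m i) \<longlonglongrightarrow> (\<Prod>i<k. b i)" using lim by (intro tendsto_intros)
    then obtain M where M: "\<And>m. m \<ge> M \<Longrightarrow> \<bar>(\<Prod>i<k. a m i) - (\<Prod>i<k. b i)\<bar> < e / 3"
      using e LIMSEQ_D[of _ _ "e / 3"] by fastforce
    show "\<exists>no. \<forall>m\<ge>no. norm (seq_prod (a m) - seq_prod b) < e"
    proof (intro exI allI impI)
      fix m assume "M \<le> m"
      from approx[of "a m" k, OF bound] approx[of b k, OF bb] M[OF this] k
      show "norm (seq_prod (a m) - seq_prod b) < e" by (simp add: abs_if split: if_splits)
    qed
  qed
qed

lemma seq_prod_measurable [measurable (raw)]:
  assumes [measurable]: "\<And>i. a i \<in> borel_measurable M"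
  shows "(\<lambda>x. seq_prod (\<lambda>i. a i x)) \<in> borel_measurable M"
  unfolding seq_prod_def by measurable

lemma exp_neg_suminf: "(\<lambda>n. \<Prod>i<n. exp_neg (t i)) \<longlonglongrightarrow> exp_neg (\<Sum>i. t i)"
  unfolding exp_neg_sum[symmetric] by (intro tendsto_exp_neg summable_LIMSEQ) auto

section \<open>Expectations of infinite products of independent variables\<close>

text \<open>
  The products \<open>W 0 \<cdots> W (m - 1) \<sqdot> \<tau> m\<close>, where \<open>\<tau> m\<close> is the tail product cut off outside \<open>[1/2, 2]\<close>, are
  dominated by the full product and converge to it; as \<open>\<tau> m\<close> is bounded and tends to \<open>1\<close>, so does
  its expectation. This needs no uniform integrability of the partial products.
\<close>

lemma (in prob_space) indep_vars_seq_prod: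
  fixes W :: "nat \<Rightarrow> 'a \<Rightarrow> real"
  assumes indep: "indep_vars (\<lambda>_. borel) W UNIV"
    and int: "\<And>i. integrable M (W i)"
    and dichotomy: "AE \<omega> in M. (\<forall>i. 0 \<le> W i \<omega> \<and> W i \<omega> \<le> 1) \<or> summable (\<lambda>i. \<bar>W i \<omega> - 1\<bar>)"
    and int_prod: "integrable M (\<lambda>\<omega>. seq_prod (\<lambda>i. W i \<omega>))"
  shows "(\<lambda>n. \<Prod>i<n. \<integral>\<omega>. W i \<omega> \<partial>M) \<longlonglongrightarrow> (\<integral>\<omega>. seq_prod (\<lambda>i. W i \<omega>) \<partial>M)"
proof -
  have [measurable]: "random_variable borel (W i)" for i
    using int by auto
  have finite_prod: "(\<integral>\<omega>. (\<Prod>i<n. W i \<omega>) \<partial>M) = (\<Prod>i<n. \<integral>\<omega>. W i \<omega> \<partial>M)"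
    "integrable M (\<lambda>\<omega>. \<Prod>i<n. W i \<omega>)" for n
    using indep_vars_subset[OF indep, of "{..<n}"] int
    by (auto intro: indep_vars_lebesgue_integral indep_vars_integrable)
  \<comment> \<open>The event of absolute convergence. As a condition on a sum in
    \<open>ennreal\<close> it is visibly measurable, and it is a tail event because finitely many
    finite terms do not affect the finiteness of the sum.\<close>
  define C where "C = {\<omega> \<in> space M. (\<Sum>i. ennreal \<bar>W i \<omega> - 1\<bar>) < \<top>}"
  have C_summable: "summable (\<lambda>i. \<bar>W i \<omega> - 1\<bar>)" if "\<omega> \<in> C" for \<omega>
    using that by (intro summable_suminf_not_top) (auto simp: C_def)
  have C_summable': "\<omega> \<in> C" if "summable (\<lambda>i. \<bar>W i \<omega> - 1\<bar>)" "\<omega> \<in> space M" for \<omega>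
    using that by (auto simp: C_def suminf_ennreal2)
  define A where "A i = {W i -` B \<inter> space M | B. B \<in> sets borel}" for i
  have "prob C = 0 \<or> prob C = 1"
  proof (rule kolmogorov_0_1_law[of A])
    show sig: "sigma_algebra (space M) (A i)" for i
      using sets.sigma_algebra_axioms[of "vimage_algebra (space M) (W i) borel"]
      by (simp add: A_def sets_vimage_algebra2)
    show "indep_sets A UNIV"
      using indep unfolding indep_vars_def2 A_def by simp
    show "C \<in> tail_events A"
      unfolding tail_events_def
    proof
      fix n
      define Mn where "Mn = sigma (space M) (\<Union>(A ` {n..}))"
      have sub: "\<Union>(A ` {n..}) \<subseteq> Pow (space M)" by (auto simp: A_def)
      have [measurable]: "W (i + n) \<in> borel_measurable Mn" for i
      proof (rule measurableI)
        fix B :: "real set" assume "B \<in> sets borel"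
        then have "W (i + n) -` B \<inter> space M \<in> \<Union>(A ` {n..})"
          by (intro UN_I[of "i + n"]) (auto simp: A_def)
        then show "W (i + n) -` B \<inter> space Mn \<in> sets Mn"
          using sub by (simp add: Mn_def space_measure_of sets_measure_of sigma_sets.Basic)
      qed auto
      have "C = {\<omega> \<in> space Mn. (\<Sum>i. ennreal \<bar>W (i + n) \<omega> - 1\<bar>) < \<top>}"
      proof -
        have "(\<Sum>i. ennreal \<bar>W i \<omega> - 1\<bar>) < \<top> \<longleftrightarrow> (\<Sum>i. ennreal \<bar>W (i + n) \<omega> - 1\<bar>) < \<top>" for \<omega>
          by (subst suminf_offset[of "\<lambda>i. ennreal \<bar>W i \<omega> - 1\<bar>" n])
            (auto simp: sum_ennreal)
        then show ?thesis using sub by (simp add: C_def Mn_def space_measure_of)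
      qed
      also have "\<dots> \<in> sets Mn" by measurable
      finally show "C \<in> sigma_sets (space M) (\<Union>(A ` {n..}))"
        using sub by (simp add: Mn_def sets_measure_of)
    qed
  qed
  moreover have [measurable]: "C \<in> sets M" unfolding C_def by measurable
  ultimately consider "AE \<omega> in M. \<omega> \<notin> C" | "AE \<omega> in M. \<omega> \<in> C"
    using prob_eq_0[of C] prob_eq_1[of C] by auto
  then show ?thesis
  proof cases
    case 1
    \<comment> \<open>Where absolute convergence fails, only the alternative of factors in [0, 1] is
      left, and the partial products are bounded by 1.\<close>
    then have unit: "AE \<omega> in M. \<forall>i. 0 \<le> W i \<omega> \<and> W i \<omega> \<le> 1"
      using dichotomy AE_space by eventually_elim (use C_summable' in blast)
    have "(\<lambda>n. \<integral>\<omega>. (\<Prod>i<n. W i \<omega>) \<partial>M) \<longlonglongrightarrow> (\<integral>\<omega>. seq_prod (\<lambda>i. W i \<omega>) \<partial>M)"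
    proof (rule integral_dominated_convergence[where w = "\<lambda>_. 1"])
      show "AE \<omega> in M. (\<lambda>n. \<Prod>i<n. W i \<omega>) \<longlonglongrightarrow> seq_prod (\<lambda>i. W i \<omega>)"
        using unit by eventually_elim (rule seq_prod_LIMSEQ_unit, blast)
      show "AE \<omega> in M. norm (\<Prod>i<n. W i \<omega>) \<le> 1" for n
        using unit by eventually_elim (auto simp: abs_prod intro!: prod_le_1)
    qed auto
    then show ?thesis by (simp add: finite_prod)
  next
    case 2
    then have sm: "AE \<omega> in M. summable (\<lambda>i. \<bar>W i \<omega> - 1\<bar>)"
      by eventually_elim (rule C_summable)
    \<comment> \<open>Values outside [1/2, 2] go to 0 instead of to the nearest endpoint, so that
      |cut t| \<le> |t|; this is what lets the full product dominate. On the interval, which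
      contains 1 in its interior, nothing changes.\<close>
    define cut where "cut t = (if 1 / 2 \<le> t \<and> t \<le> 2 then t else 0)" for t :: real
    have [measurable]: "cut \<in> borel_measurable borel" unfolding cut_def by measurable
    have cut_bound: "\<bar>cut t\<bar> \<le> \<bar>t\<bar>" "\<bar>cut t\<bar> \<le> 2" for t by (auto simp: cut_def)
    define \<tau> where "\<tau> m \<omega> = cut (seq_prod (\<lambda>i. W (i + m) \<omega>))" for m \<omega>
    have [measurable]: "random_variable borel (\<tau> m)" for m unfolding \<tau>_def by measurable
    have int_\<tau>: "integrable M (\<tau> m)" for m
      by (rule integrable_const_bound[of _ 2]) (auto simp: \<tau>_def cut_bound)
    have tail: "AE \<omega> in M. \<forall>\<^sub>F m in sequentially. \<tau> m \<omega> = seq_prod (\<lambda>i. W (i + m) \<omega>)"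
      using sm
    proof eventually_elim
      case (elim \<omega>)
      note lim = seq_prod_tail_tendsto_1[OF elim]
      from order_tendstoD(1)[OF lim, of "1 / 2"] order_tendstoD(2)[OF lim, of 2]
      show ?case by (auto simp: \<tau>_def cut_def elim: eventually_elim2)
    qed
    have lim_\<tau>: "(\<lambda>m. \<integral>\<omega>. \<tau> m \<omega> \<partial>M) \<longlonglongrightarrow> (\<integral>\<omega>. 1 \<partial>M)"
    proof (rule integral_dominated_convergence[where w = "\<lambda>_. 2"])
      show "AE \<omega> in M. (\<lambda>m. \<tau> m \<omega>) \<longlonglongrightarrow> 1"
        using sm tail
      proof eventually_elim
        case (elim \<omega>)
        show ?case
          by (rule Lim_transform_eventually[OF seq_prod_tail_tendsto_1[OF elim(1)]])
            (use elim(2) in \<open>auto elim: eventually_mono\<close>)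
      qed
    qed (auto simp: \<tau>_def cut_bound)
    have lim_Z: "(\<lambda>m. \<integral>\<omega>. (\<Prod>i<m. W i \<omega>) * \<tau> m \<omega> \<partial>M) \<longlonglongrightarrow> (\<integral>\<omega>. seq_prod (\<lambda>i. W i \<omega>) \<partial>M)"
    proof (rule integral_dominated_convergence[where w = "\<lambda>\<omega>. \<bar>seq_prod (\<lambda>i. W i \<omega>)\<bar>"])
      show "AE \<omega> in M. norm ((\<Prod>i<m. W i \<omega>) * \<tau> m \<omega>) \<le> \<bar>seq_prod (\<lambda>i. W i \<omega>)\<bar>" for m
        using sm
      proof eventually_elim
        case (elim \<omega>)
        show ?case
          unfolding seq_prod_split[OF elim, of m] \<tau>_def real_norm_def abs_mult
          by (intro mult_left_mono cut_bound) auto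
      qed
      show "AE \<omega> in M. (\<lambda>m. (\<Prod>i<m. W i \<omega>) * \<tau> m \<omega>) \<longlonglongrightarrow> seq_prod (\<lambda>i. W i \<omega>)"
        using sm tail
      proof eventually_elim
        case (elim \<omega>)
        from elim(2) have "\<forall>\<^sub>F m in sequentially. (\<Prod>i<m. W i \<omega>) * \<tau> m \<omega> = seq_prod (\<lambda>i. W i \<omega>)"
          by eventually_elim (simp flip: seq_prod_split[OF elim(1)])
        then show ?case by (rule tendsto_eventually)
      qed
    qed (use int_prod in auto)
    have "(\<integral>\<omega>. (\<Prod>i<m. W i \<omega>) * \<tau> m \<omega> \<partial>M) = (\<Prod>i<m. \<integral>\<omega>. W i \<omega> \<partial>M) * (\<integral>\<omega>. \<tau> m \<omega> \<partial>M)" for m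
    proof -
      let ?L = "\<lambda>x. \<Prod>i<m. x i" and ?R = "\<lambda>x. cut (seq_prod (\<lambda>i. x (i + m)))"
      have "indep_var borel (?L \<circ> (\<lambda>\<omega>. restrict (\<lambda>i. W i \<omega>) {..<m}))
          borel (?R \<circ> (\<lambda>\<omega>. restrict (\<lambda>i. W i \<omega>) {m..}))"
        by (rule indep_var_compose[OF indep_var_restrict[OF indep]]) (auto, measurable)
      moreover have "?L \<circ> (\<lambda>\<omega>. restrict (\<lambda>i. W i \<omega>) {..<m}) = (\<lambda>\<omega>. \<Prod>i<m. W i \<omega>)"
        "?R \<circ> (\<lambda>\<omega>. restrict (\<lambda>i. W i \<omega>) {m..}) = \<tau> m"
        by (auto simp: \<tau>_def)
      ultimately have "indep_var borel (\<lambda>\<omega>. \<Prod>i<m. W i \<omega>) borel (\<tau> m)" by simp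
      from indep_var_lebesgue_integral[OF this finite_prod(2) int_\<tau>]
      show ?thesis by (simp add: finite_prod)
    qed
    with lim_Z have "(\<lambda>m. (\<Prod>i<m. \<integral>\<omega>. W i \<omega> \<partial>M) * (\<integral>\<omega>. \<tau> m \<omega> \<partial>M)) \<longlonglongrightarrow>
        (\<integral>\<omega>. seq_prod (\<lambda>i. W i \<omega>) \<partial>M)" by simp
    \<comment> \<open>The expectation of the cut tail tends to 1, hence is eventually nonzero and
      can be divided out. What remains are the partial products of the means.\<close>
    from tendsto_divide[OF this lim_\<tau>]
    have lim: "(\<lambda>m. (\<Prod>i<m. \<integral>\<omega>. W i \<omega> \<partial>M) * (\<integral>\<omega>. \<tau> m \<omega> \<partial>M) / (\<integral>\<omega>. \<tau> m \<omega> \<partial>M)) \<longlonglongrightarrow>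
        (\<integral>\<omega>. seq_prod (\<lambda>i. W i \<omega>) \<partial>M)" by (simp add: prob_space)
    have "\<forall>\<^sub>F m in sequentially. (\<integral>\<omega>. \<tau> m \<omega> \<partial>M) \<noteq> 0"
      using lim_\<tau> by (intro tendsto_imp_eventually_ne[of _ 1]) (auto simp: prob_space)
    then show ?thesis
      by (intro Lim_transform_eventually[OF lim]) (auto elim: eventually_mono)
  qed
qed

section \<open>Products over a random sample with independent marks\<close>

lemma sample_space_fst [measurable]: "fst \<in> sample_space \<rightarrow>\<^sub>M count_space UNIV"
  and sample_space_snd [measurable]: "(\<lambda>r. snd r i) \<in> sample_space \<rightarrow>\<^sub>M borel"
  unfolding sample_space_def by measurable

text \<open>By \<open>joint\<close> the expectation is an iterated integral. For almost every fixed
  sample the factors are independent, and the infinite product of their means is the inner integral.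
  The marks may have different laws: only the means \<open>g\<close> must agree. This is essential
  because subtrees may be enumerated in different ways.\<close>

lemma marked_product_expectation:
  fixes N :: "'w \<Rightarrow> 'a::topological_space sample" and T :: "nat \<Rightarrow> 'w \<Rightarrow> 't"
    and w :: "'a \<Rightarrow> 't \<Rightarrow> real"
  defines "W \<equiv> \<lambda>r t i. if enat i < fst r then w (snd r i) (t i) else 1"
  assumes prob: "prob_space M"
    and T: "prob_space.indep_vars M (\<lambda>_. K) T UNIV"
    and rN [measurable]: "N \<in> M \<rightarrow>\<^sub>M sample_space"
    and joint: "distr M sample_space N \<Otimes>\<^sub>M distr M (PiM UNIV (\<lambda>_. K)) (\<lambda>\<omega> i. T i \<omega>) =
      distr M (sample_space \<Otimes>\<^sub>M PiM UNIV (\<lambda>_. K)) (\<lambda>\<omega>. (N \<omega>, \<lambda>i. T i \<omega>))"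
    and w [measurable]: "case_prod w \<in> borel_measurable (borel \<Otimes>\<^sub>M K)"
    and int: "\<And>x i. integrable M (\<lambda>\<omega>. w x (T i \<omega>))"
    and mean: "\<And>x i. (\<integral>\<omega>. w x (T i \<omega>) \<partial>M) = g x"
    and dichotomy: "AE \<omega> in M. (\<forall>i. 0 \<le> W (N \<omega>) (\<lambda>i. T i \<omega>) i \<and> W (N \<omega>) (\<lambda>i. T i \<omega>) i \<le> 1) \<or>
      summable (\<lambda>i. \<bar>W (N \<omega>) (\<lambda>i. T i \<omega>) i - 1\<bar>)"
    and int_prod: "integrable M (\<lambda>\<omega>. seq_prod (W (N \<omega>) (\<lambda>i. T i \<omega>)))"
  shows "(\<integral>\<omega>. seq_prod (W (N \<omega>) (\<lambda>i. T i \<omega>)) \<partial>M) =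
    (\<integral>\<omega>. seq_prod (\<lambda>i. if enat i < fst (N \<omega>) then g (snd (N \<omega>) i) else 1) \<partial>M)"
proof -
  interpret prob_space M by fact
  let ?P = "PiM UNIV (\<lambda>_::nat. K)" and ?T = "\<lambda>\<omega> i. T i \<omega>"
  have rTi [measurable]: "random_variable K (T i)" for i
    using T by (auto simp: indep_vars_def)
  have rT [measurable]: "random_variable ?P ?T"
    by (rule measurable_PiM_single') (auto intro: measurable_space[OF rTi])
  interpret N: prob_space "distr M sample_space N" by (rule prob_space_distr) fact
  interpret T: prob_space "distr M ?P ?T" by (rule prob_space_distr) fact
  interpret NT: pair_prob_space "distr M sample_space N" "distr M ?P ?T" ..
  have W_m [measurable]: "(\<lambda>(r, t). W r t i) \<in> borel_measurable (sample_space \<Otimes>\<^sub>M ?P)" for i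
    unfolding W_def by measurable
  let ?Z = "\<lambda>(r, t). seq_prod (W r t)"
  have Z_m [measurable]: "?Z \<in> borel_measurable (sample_space \<Otimes>\<^sub>M ?P)"
    using seq_prod_measurable[OF W_m] by (simp add: case_prod_unfold)
  \<comment> \<open>Summability is phrased as finiteness of a sum in \<open>ennreal\<close> so that
    the dichotomy becomes a measurable predicate and passes to almost every section.\<close>
  let ?D = "\<lambda>(r, t). (\<forall>i. 0 \<le> W r t i \<and> W r t i \<le> 1) \<or> (\<Sum>i. ennreal \<bar>W r t i - 1\<bar>) < \<top>"
  have D_iff: "?D (r, t) \<longleftrightarrow> (\<forall>i. 0 \<le> W r t i \<and> W r t i \<le> 1) \<or> summable (\<lambda>i. \<bar>W r t i - 1\<bar>)" for r t
    by (auto intro: summable_suminf_not_top simp: suminf_ennreal2)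
  have D_m [measurable]: "Measurable.pred (sample_space \<Otimes>\<^sub>M ?P) ?D"
    by measurable
  have int_Z: "integrable (distr M sample_space N \<Otimes>\<^sub>M distr M ?P ?T) ?Z"
    unfolding joint using int_prod by (subst integrable_distr_eq) auto
  have "AE \<omega> in M. ?D (N \<omega>, ?T \<omega>)"
    using dichotomy by (simp only: D_iff)
  then have "AE p in distr M sample_space N \<Otimes>\<^sub>M distr M ?P ?T. ?D p"
    unfolding joint by (rule iffD2[OF AE_distr_iff[OF _ predE[OF D_m]], rotated]) measurable
  then have D: "AE r in distr M sample_space N. AE t in distr M ?P ?T. ?D (r, t)"
    by (rule NT.AE_pair)
  have int_r: "AE r in distr M sample_space N. integrable (distr M ?P ?T) (\<lambda>t. ?Z (r, t))"
    using NT.AE_integrable_fst'[OF int_Z] by simp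
  \<comment> \<open>\<open>g\<close> is the integral of \<open>w\<close> against the law of the mark
    with index 0, and inherits measurability from there.\<close>
  have [measurable]: "g \<in> borel_measurable borel"
    unfolding mean[of _ 0, symmetric] by measurable
  have inner: "AE r in distr M sample_space N. (\<integral>t. ?Z (r, t) \<partial>distr M ?P ?T) =
      seq_prod (\<lambda>i. if enat i < fst r then g (snd r i) else 1)"
    using D int_r AE_space
  proof eventually_elim
    case (elim r)
    then have [simp]: "r \<in> space sample_space" by simp
    have [measurable]: "(\<lambda>t. W r t i) \<in> borel_measurable ?P" for i
      using measurable_Pair2[OF W_m] by simp
    have D_r: "AE \<omega> in M. ?D (r, ?T \<omega>)"
      by (rule iffD1[OF AE_distr_iff[OF rT predE[OF measurable_Pair2[OF D_m]]] elim(1)]) simp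
    have int_r: "integrable M (\<lambda>\<omega>. seq_prod (\<lambda>i. W r (?T \<omega>) i))"
      using elim(2) by (subst (asm) integrable_distr_eq) auto
    have "(\<lambda>n. \<Prod>i<n. \<integral>\<omega>. W r (?T \<omega>) i \<partial>M) \<longlonglongrightarrow> (\<integral>\<omega>. seq_prod (\<lambda>i. W r (?T \<omega>) i) \<partial>M)"
    proof (rule indep_vars_seq_prod[where W = "\<lambda>i \<omega>. W r (?T \<omega>) i"])
      show "indep_vars (\<lambda>_. borel) (\<lambda>i \<omega>. W r (?T \<omega>) i) UNIV"
        using indep_vars_compose2[OF T, of "\<lambda>i t. if enat i < fst r then w (snd r i) t else 1" "\<lambda>_. borel"]
        by (simp add: W_def)
      show "integrable M (\<lambda>\<omega>. W r (?T \<omega>) i)" for i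
        using int by (cases "enat i < fst r") (simp_all add: W_def)
      show "AE \<omega> in M. (\<forall>i. 0 \<le> W r (?T \<omega>) i \<and> W r (?T \<omega>) i \<le> 1) \<or>
          summable (\<lambda>i. \<bar>W r (?T \<omega>) i - 1\<bar>)"
        using D_r by (simp only: D_iff)
    qed fact
    moreover have "(\<integral>\<omega>. W r (?T \<omega>) i \<partial>M) = (if enat i < fst r then g (snd r i) else 1)" for i
      by (simp add: W_def mean prob_space)
    ultimately have "(\<integral>\<omega>. seq_prod (\<lambda>i. W r (?T \<omega>) i) \<partial>M) =
        seq_prod (\<lambda>i. if enat i < fst r then g (snd r i) else 1)"
      by (simp add: seq_prod_eqI)
    then show ?case by (subst integral_distr) auto
  qed
  have "(\<integral>\<omega>. seq_prod (W (N \<omega>) (?T \<omega>)) \<partial>M) = (\<integral>p. ?Z p \<partial>(distr M sample_space N \<Otimes>\<^sub>M distr M ?P ?T))"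
    unfolding joint by (subst integral_distr) auto
  also have "\<dots> = (\<integral>r. \<integral>t. ?Z (r, t) \<partial>distr M ?P ?T \<partial>distr M sample_space N)"
    by (rule NT.integral_fst'[OF int_Z, symmetric])
  also have "\<dots> = (\<integral>r. seq_prod (\<lambda>i. if enat i < fst r then g (snd r i) else 1) \<partial>distr M sample_space N)"
    using inner by (intro integral_cong_AE) (use borel_measurable_integrable[OF NT.integrable_fst'[OF int_Z]] in auto)
  also have "\<dots> = (\<integral>\<omega>. seq_prod (\<lambda>i. if enat i < fst (N \<omega>) then g (snd (N \<omega>) i) else 1) \<partial>M)"
    by (subst integral_distr) auto
  finally show ?thesis .
qed

section \<open>The generating functional of a Poisson process\<close>

lemma space_sample_space [simp]: "space sample_space = UNIV"
  by (simp add: sample_space_def space_pair_measure space_PiM)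

text \<open>The point probabilities add up to exp l * exp (-l) = 1, which forces the
  \<open>ennreal\<close>-valued \<open>X\<close> to be a natural number almost surely. Summing c^k
  over the events X = k gives the exponential series; it converges absolutely, so \<open>c\<close>
  may have either sign.\<close>

lemma (in prob_space) poisson_power_expectation:
  fixes X :: "'a \<Rightarrow> ennreal" and c l :: real
  assumes X [measurable]: "random_variable borel X"
    and poisson: "\<And>k. prob {\<omega> \<in> space M. X \<omega> = of_nat k} = l ^ k / fact k * exp (- l)"
  shows "AE \<omega> in M. X \<omega> \<in> range of_nat"
    and "integrable M (\<lambda>\<omega>. c ^ nat \<lfloor>enn2real (X \<omega>)\<rfloor>)"
    and "(\<integral>\<omega>. c ^ nat \<lfloor>enn2real (X \<omega>)\<rfloor> \<partial>M) = exp (l * (c - 1))"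
proof -
  define A where "A k = {\<omega> \<in> space M. X \<omega> = of_nat k}" for k
  have [measurable]: "A k \<in> events" for k unfolding A_def by measurable
  have floor_nat: "nat \<lfloor>enn2real (of_nat k)\<rfloor> = k" for k by (simp add: enn2real_of_nat)
  have disj: "disjoint_family A" by (auto simp: disjoint_family_on_def A_def)
  have sums: "(\<lambda>k. prob (A k)) sums prob (\<Union>k. A k)"
    by (rule finite_measure_UNION) (use disj in auto)
  have exp_sums: "(\<lambda>k. y ^ k / fact k * exp (- l)) sums (exp y * exp (- l))" for y :: real
    using exp_converges[of y] by (intro sums_mult2) (simp add: field_simps)
  have "prob (\<Union>k. A k) = exp l * exp (- l)"
    using sums exp_sums[of l] unfolding A_def poisson by (rule sums_unique2)
  then have "prob (\<Union>k. A k) = 1" by (simp flip: exp_add)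
  then have "AE \<omega> in M. \<omega> \<in> (\<Union>k. A k)" by (subst (asm) prob_eq_1) auto
  then show nat_valued: "AE \<omega> in M. X \<omega> \<in> range of_nat"
    by eventually_elim (auto simp: A_def)
  define F where "F k \<omega> = c ^ k * indicator (A k) \<omega>" for k \<omega>
  have F_sums: "(\<lambda>k. F k \<omega>) sums (c ^ n)" "summable (\<lambda>k. norm (F k \<omega>))"
    if "X \<omega> = of_nat n" "\<omega> \<in> space M" for \<omega> n
  proof -
    have F: "F k \<omega> = (if k = n then c ^ n else 0)" for k using that by (auto simp: F_def A_def)
    show "(\<lambda>k. F k \<omega>) sums (c ^ n)" unfolding F using sums_single[of n "\<lambda>k. c ^ k"] by (simp cong: if_cong)
    show "summable (\<lambda>k. norm (F k \<omega>))" unfolding F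
      by (rule summable_finite[of "{n}"]) auto
  qed
  have AE_sm: "AE \<omega> in M. summable (\<lambda>k. norm (F k \<omega>))"
    and AE_eq: "AE \<omega> in M. (\<Sum>k. F k \<omega>) = c ^ nat \<lfloor>enn2real (X \<omega>)\<rfloor>"
  proof -
    show "AE \<omega> in M. summable (\<lambda>k. norm (F k \<omega>))"
      using nat_valued AE_space by eventually_elim (auto intro: F_sums(2)[unfolded real_norm_def])
    show "AE \<omega> in M. (\<Sum>k. F k \<omega>) = c ^ nat \<lfloor>enn2real (X \<omega>)\<rfloor>"
      using nat_valued AE_space
      by eventually_elim (auto simp: floor_nat intro!: sums_unique[symmetric] F_sums(1))
  qed
  have int_F: "integrable M (F k)" for k
    unfolding F_def by (intro integrable_mult_right integrable_real_indicator) (auto simp: emeasure_eq_measure)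
  have norm_F: "(\<integral>\<omega>. norm (F k \<omega>) \<partial>M) = \<bar>c\<bar> ^ k * (l ^ k / fact k * exp (- l))" for k
    unfolding poisson[symmetric] A_def[symmetric] by (simp add: F_def abs_mult power_abs)
  have "summable (\<lambda>k. (\<bar>c\<bar> * l) ^ k / fact k * exp (- l))"
    using exp_sums by (rule sums_summable)
  then have sm: "summable (\<lambda>k. \<integral>\<omega>. norm (F k \<omega>) \<partial>M)"
    unfolding norm_F by (simp add: power_mult_distrib algebra_simps)
  have eq: "(\<lambda>k. \<integral>\<omega>. F k \<omega> \<partial>M) sums (\<integral>\<omega>. (\<Sum>k. F k \<omega>) \<partial>M)"
    by (rule sums_integral[OF int_F AE_sm sm])
  have "integrable M (\<lambda>\<omega>. \<Sum>k. F k \<omega>)"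
    by (rule integrable_suminf[OF int_F AE_sm sm])
  then show "integrable M (\<lambda>\<omega>. c ^ nat \<lfloor>enn2real (X \<omega>)\<rfloor>)"
    by (rule integrable_cong_AE_imp) (use AE_eq in \<open>auto simp: eq_commute\<close>)
  have "(\<integral>\<omega>. F k \<omega> \<partial>M) = (c * l) ^ k / fact k * exp (- l)" for k
  proof -
    have "(\<integral>\<omega>. F k \<omega> \<partial>M) = c ^ k * prob (A k)" by (simp add: F_def)
    then show ?thesis by (simp add: A_def poisson power_mult_distrib)
  qed
  then have "(\<integral>\<omega>. (\<Sum>k. F k \<omega>) \<partial>M) = exp (c * l) * exp (- l)"
    using eq exp_sums[of "c * l"] by (simp add: sums_unique2)
  moreover have "(\<integral>\<omega>. (\<Sum>k. F k \<omega>) \<partial>M) = (\<integral>\<omega>. c ^ nat \<lfloor>enn2real (X \<omega>)\<rfloor> \<partial>M)"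
    using AE_eq by (intro integral_cong_AE) (auto simp: F_def)
  ultimately show "(\<integral>\<omega>. c ^ nat \<lfloor>enn2real (X \<omega>)\<rfloor> \<partial>M) = exp (l * (c - 1))"
    by (simp add: algebra_simps flip: exp_add)
qed

lemma sample_count_eq:
  assumes "A \<in> sets borel"
  shows "sample_count r A =
    (if finite {i. enat i < fst r \<and> snd r i \<in> A} then of_nat (card {i. enat i < fst r \<and> snd r i \<in> A}) else \<top>)"
proof -
  have "snd r -` A \<inter> {i. enat i < fst r} = {i. enat i < fst r \<and> snd r i \<in> A}" by auto
  moreover have "{i. enat i < fst r \<and> snd r i \<in> A} \<subseteq> {i. enat i < fst r}" by auto
  ultimately show ?thesis
    using assms by (simp add: dirac_sum_def sample_config_def emeasure_distr emeasure_count_space)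
qed

definition sample_prod :: "('a \<Rightarrow> real) \<Rightarrow> 'a sample \<Rightarrow> real" where
  "sample_prod h r = seq_prod (\<lambda>i. if enat i < fst r then h (snd r i) else 1)"

lemma sample_prod_measurable [measurable]:
  fixes h :: "'a::topological_space \<Rightarrow> real"
  assumes [measurable]: "h \<in> borel_measurable borel"
  shows "sample_prod h \<in> borel_measurable sample_space"
  unfolding sample_prod_def by measurable

text \<open>On the level sets B_j of the nonzero values v_j the product equals the finite product of
  (1 + v_j) ^ N(B_j). The counts are independent Poisson variables, so the expectation factorises
  into the exponentials exp (\<mu>(B_j) v_j).\<close>

lemma poisson_PGFl_simple:
  fixes \<mu> :: "'a::topological_space measure" and s :: "'a \<Rightarrow> real"
  assumes prob: "prob_space M" and \<mu>: "sets \<mu> = sets borel" and N: "poisson_process M \<mu> N"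
    and s: "simple_function \<mu> s" "emeasure \<mu> {x \<in> space \<mu>. s x \<noteq> 0} \<noteq> \<infinity>"
  shows "AE \<omega> in M. finite {i. enat i < fst (N \<omega>) \<and> s (snd (N \<omega>) i) \<noteq> 0}"
    and "integrable M (\<lambda>\<omega>. sample_prod (\<lambda>x. 1 + s x) (N \<omega>))"
    and "(\<integral>\<omega>. sample_prod (\<lambda>x. 1 + s x) (N \<omega>) \<partial>M) = exp (\<integral>x. s x \<partial>\<mu>)"
proof -
  interpret prob_space M by fact
  have sp: "space \<mu> = UNIV" using sets_eq_imp_space_eq[OF \<mu>] by simp
  define V where "V = s ` UNIV - {0}"
  have fin: "finite V" using s(1) by (simp add: V_def simple_function_def sp)
  define n where "n = card V"
  obtain v where v: "bij_betw v {0..<n} V"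
    using ex_bij_betw_nat_finite[OF fin] n_def by blast
  \<comment> \<open>Padding with empty sets gives an infinite disjoint sequence, the form in which
    \<open>poisson_process\<close> provides independence.\<close>
  define B where "B j = (if j < n then s -` {v j} else {})" for j
  have B_sets [measurable]: "B j \<in> sets borel" for j
    using simple_functionD(2)[OF s(1), of "{v j}"] \<mu> by (simp add: B_def sp)
  have vn: "v j \<noteq> 0" if "j < n" for j using v that by (auto simp: bij_betw_def V_def)
  have B_fin: "emeasure \<mu> (B j) < \<infinity>" for j
  proof -
    have "emeasure \<mu> (B j) \<le> emeasure \<mu> {x \<in> space \<mu>. s x \<noteq> 0}"
      using simple_functionD(2)[OF s(1), of "- {0}"] vn
      by (intro emeasure_mono) (auto simp: B_def sp vimage_def split: if_splits)
    then show ?thesis using s(2) by (auto simp: less_top top_unique)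
  qed
  have disj: "disjoint_family B"
    using v by (auto simp: disjoint_family_on_def B_def bij_betw_def inj_on_def)
  define X where "X j \<omega> = sample_count (N \<omega>) (B j)" for j \<omega>
  have indep: "indep_vars (\<lambda>_. borel) X UNIV"
    using N disj B_sets unfolding poisson_process_def X_def by blast
  have X_poisson: "prob {\<omega> \<in> space M. X j \<omega> = of_nat k} =
      measure \<mu> (B j) ^ k / fact k * exp (- measure \<mu> (B j))" for j k
    using N B_fin B_sets unfolding poisson_process_def X_def by blast
  have X_m [measurable]: "random_variable borel (X j)" for j
    using indep by (auto simp: indep_vars_def)
  note X_power = poisson_power_expectation[OF X_m X_poisson]
  have nat_valued: "AE \<omega> in M. \<forall>j. X j \<omega> \<in> range of_nat"
    using X_power(1) by (simp add: AE_all_countable)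
  define I where "I j \<omega> = {i. enat i < fst (N \<omega>) \<and> snd (N \<omega>) i \<in> B j}" for j \<omega>
  have I_fin: "finite (I j \<omega>)" and I_card: "card (I j \<omega>) = nat \<lfloor>enn2real (X j \<omega>)\<rfloor>"
    if "\<forall>j. X j \<omega> \<in> range of_nat" for j \<omega>
    using that[rule_format, of j] sample_count_eq[OF B_sets, of "N \<omega>" j]
    by (auto simp: X_def I_def enn2real_of_nat split: if_splits)
  have union: "{i. enat i < fst (N \<omega>) \<and> s (snd (N \<omega>) i) \<noteq> 0} = (\<Union>j<n. I j \<omega>)" for \<omega>
  proof -
    have "\<exists>j<n. s x = v j" if "s x \<noteq> 0" for x
    proof -
      have "s x \<in> v ` {0..<n}" using v that by (auto simp: bij_betw_def V_def)
      then show ?thesis by auto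
    qed
    then show ?thesis using vn by (fastforce simp: I_def B_def)
  qed
  show "AE \<omega> in M. finite {i. enat i < fst (N \<omega>) \<and> s (snd (N \<omega>) i) \<noteq> 0}"
    using nat_valued unfolding union by eventually_elim (auto intro: I_fin)
  have prod_eq: "AE \<omega> in M. sample_prod (\<lambda>x. 1 + s x) (N \<omega>) =
      (\<Prod>j<n. (1 + v j) ^ nat \<lfloor>enn2real (X j \<omega>)\<rfloor>)"
    using nat_valued
  proof eventually_elim
    case (elim \<omega>)
    let ?h = "\<lambda>i. if enat i < fst (N \<omega>) then 1 + s (snd (N \<omega>) i) else 1"
    have fU: "finite (\<Union>j<n. I j \<omega>)" using I_fin[OF elim] by auto
    have one: "?h i = 1" if "i \<notin> (\<Union>j<n. I j \<omega>)" for i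
      using that unfolding union[symmetric] by auto
    \<comment> \<open>All indices with a factor different from 1 lie below \<open>k\<close>, so the
      partial products are constant from there on.\<close>
    obtain k where k: "(\<Union>j<n. I j \<omega>) \<subseteq> {..<k}"
      using finite_nat_bounded[OF fU] by auto
    have "(\<Prod>i<m. ?h i) = (\<Prod>i\<in>(\<Union>j<n. I j \<omega>). ?h i)" if "k \<le> m" for m
      using k that one by (intro prod.mono_neutral_right) auto
    then have "\<forall>\<^sub>F m in sequentially. (\<Prod>i<m. ?h i) = (\<Prod>i\<in>(\<Union>j<n. I j \<omega>). ?h i)"
      by (rule eventually_sequentiallyI)
    then have "sample_prod (\<lambda>x. 1 + s x) (N \<omega>) = (\<Prod>i\<in>(\<Union>j<n. I j \<omega>). ?h i)"
      unfolding sample_prod_def by (intro seq_prod_eqI tendsto_eventually)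
    also have "\<dots> = (\<Prod>j<n. \<Prod>i\<in>I j \<omega>. ?h i)"
      using I_fin[OF elim] disj
      by (intro prod.UNION_disjoint) (auto simp: I_def disjoint_family_on_def)
    also have "\<dots> = (\<Prod>j<n. \<Prod>i\<in>I j \<omega>. 1 + v j)"
      by (intro prod.cong refl) (auto simp: I_def B_def)
    also have "\<dots> = (\<Prod>j<n. (1 + v j) ^ nat \<lfloor>enn2real (X j \<omega>)\<rfloor>)"
      by (simp add: I_card[OF elim])
    finally show ?case .
  qed
  have indep': "indep_vars (\<lambda>_. borel) (\<lambda>j \<omega>. (1 + v j) ^ nat \<lfloor>enn2real (X j \<omega>)\<rfloor>) {..<n}"
    by (rule indep_vars_compose2[OF indep_vars_subset[OF indep subset_UNIV],
          where Y = "\<lambda>j x. (1 + v j) ^ nat \<lfloor>enn2real x\<rfloor>"]) measurable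
  have hm [measurable]: "(\<lambda>x. 1 + s x) \<in> borel_measurable borel"
    using borel_measurable_simple_function[OF s(1)] by (simp add: measurable_cong_sets[OF \<mu> refl])
  have [measurable]: "N \<in> M \<rightarrow>\<^sub>M sample_space" using N by (simp add: poisson_process_def)
  have "integrable M (\<lambda>\<omega>. \<Prod>j<n. (1 + v j) ^ nat \<lfloor>enn2real (X j \<omega>)\<rfloor>)"
    by (rule indep_vars_integrable[OF _ indep' X_power(2)]) auto
  then show "integrable M (\<lambda>\<omega>. sample_prod (\<lambda>x. 1 + s x) (N \<omega>))"
    by (rule integrable_cong_AE_imp) (use prod_eq in auto)
  have "(\<integral>\<omega>. sample_prod (\<lambda>x. 1 + s x) (N \<omega>) \<partial>M) =
      (\<integral>\<omega>. (\<Prod>j<n. (1 + v j) ^ nat \<lfloor>enn2real (X j \<omega>)\<rfloor>) \<partial>M)"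
    using prod_eq by (intro integral_cong_AE) auto
  also have "\<dots> = (\<Prod>j<n. exp (measure \<mu> (B j) * (1 + v j - 1)))"
    by (subst indep_vars_lebesgue_integral[OF _ indep' X_power(2)]) (auto simp only: X_power(3))
  also have "\<dots> = exp (\<Sum>j<n. measure \<mu> (B j) * v j)"
    by (simp add: exp_sum)
  also have "(\<Sum>j<n. measure \<mu> (B j) * v j) = (\<Sum>y\<in>V. measure \<mu> {x. s x = y} * y)"
    by (subst sum.reindex_bij_betw[OF v, symmetric])
      (auto simp: B_def vimage_def atLeast0LessThan intro!: sum.cong)
  also have "\<dots> = Bochner_Integration.simple_bochner_integral \<mu> s"
    using fin by (subst simple_bochner_integral_def) (auto simp: sp V_def intro!: sum.mono_neutral_cong_left)
  also have "\<dots> = (\<integral>x. s x \<partial>\<mu>)"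
    using s by (intro simple_bochner_integrable_eq_integral simple_bochner_integrable.intros) auto
  finally show "(\<integral>\<omega>. sample_prod (\<lambda>x. 1 + s x) (N \<omega>) \<partial>M) = exp (\<integral>x. s x \<partial>\<mu>)" .
qed

text \<open>Supplies the integrable majorant for general integrands. The factor 2 in the exponent
  stems from the approximating simple functions, which satisfy |s m x| \<le> 2 g x. Fatou's lemma
  handles m for a fixed number n of factors; monotone convergence then handles n.\<close>

lemma poisson_PGFl_bound:
  fixes \<mu> :: "'a::topological_space measure" and g :: "'a \<Rightarrow> real"
  assumes prob: "prob_space M" and \<mu>: "sets \<mu> = sets borel" and N: "poisson_process M \<mu> N"
    and g: "integrable \<mu> g" "\<And>x. 0 \<le> g x"
  shows "(\<integral>\<^sup>+\<omega>. (SUP n. ennreal (\<Prod>i<n. if enat i < fst (N \<omega>) then 1 + g (snd (N \<omega>) i) else 1)) \<partial>M)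
    \<le> ennreal (exp (2 * (\<integral>x. g x \<partial>\<mu>)))"
proof -
  interpret prob_space M by fact
  have sp: "space \<mu> = UNIV" using sets_eq_imp_space_eq[OF \<mu>] by simp
  have [measurable]: "N \<in> M \<rightarrow>\<^sub>M sample_space" using N by (simp add: poisson_process_def)
  have [measurable]: "g \<in> borel_measurable borel"
    using g(1) by (simp add: integrable_iff_bounded measurable_cong_sets[OF \<mu> refl])
  obtain s where s: "\<And>m. simple_function \<mu> (s m)" "\<And>x. (\<lambda>m. s m x) \<longlonglongrightarrow> g x"
    "\<And>m x. \<bar>s m x\<bar> \<le> 2 * g x"
  proof -
    from borel_measurable_implies_sequence_metric[OF borel_measurable_integrable[OF g(1)], of 0]
    obtain F where "\<And>m. simple_function \<mu> (F m)" "\<And>x. (\<lambda>m. F m x) \<longlonglongrightarrow> g x"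
      "\<And>m x. \<bar>F m x\<bar> \<le> 2 * \<bar>g x\<bar>"
      by (auto simp: sp)
    then show ?thesis using g(2) by (intro that[of F]) auto
  qed
  let ?P = "\<lambda>u n \<omega>. \<Prod>i<n. if enat i < fst (N \<omega>) then 1 + u (snd (N \<omega>) i) else (1::real)"
  have P_inc: "incseq (\<lambda>n. ?P u n \<omega>)" and P_pos: "0 \<le> ?P u n \<omega>"
    if "\<And>x. 0 \<le> u x" for u :: "'a \<Rightarrow> real" and n \<omega>
  proof -
    show pos: "0 \<le> ?P u n \<omega>" for n using that by (intro prod_nonneg) (auto simp: add_nonneg_nonneg)
    show "incseq (\<lambda>n. ?P u n \<omega>)"
    proof (rule incseq_SucI)
      fix n
      have "?P u n \<omega> * 1 \<le> ?P u n \<omega> * (if enat n < fst (N \<omega>) then 1 + u (snd (N \<omega>) n) else 1)"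
        using that by (intro mult_left_mono pos) auto
      then show "?P u n \<omega> \<le> ?P u (Suc n) \<omega>" by (simp only: prod.lessThan_Suc mult_1_right)
    qed
  qed
  have abs_s: "simple_function \<mu> (\<lambda>x. \<bar>s m x\<bar>)" for m
    using s(1) by (rule simple_function_compose1)
  have supp: "emeasure \<mu> {x \<in> space \<mu>. \<bar>s m x\<bar> \<noteq> 0} \<noteq> \<infinity>" for m
  proof -
    have "integrable \<mu> (s m)"
      by (rule Bochner_Integration.integrable_bound[OF integrable_mult_right[OF g(1), of 2]])
        (use s(1,3) g(2) in \<open>auto intro: borel_measurable_simple_function\<close>)
    then have "Bochner_Integration.simple_bochner_integrable \<mu> (s m)"
      using s(1)[of m] by (intro simple_bochner_integrableI_bounded) (auto simp: integrable_iff_bounded)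
    then show ?thesis by (simp add: simple_bochner_integrable.simps)
  qed
  have bound_s: "(\<integral>\<^sup>+\<omega>. ennreal (?P (\<lambda>x. \<bar>s m x\<bar>) n \<omega>) \<partial>M) \<le> ennreal (exp (2 * (\<integral>x. g x \<partial>\<mu>)))" for m n
  proof -
    note simple = poisson_PGFl_simple[OF prob \<mu> N abs_s supp, of m]
    have le: "AE \<omega> in M. ?P (\<lambda>x. \<bar>s m x\<bar>) n \<omega> \<le> sample_prod (\<lambda>x. 1 + \<bar>s m x\<bar>) (N \<omega>)"
      using simple(1)
    proof eventually_elim
      case (elim \<omega>)
      have "summable (\<lambda>i. \<bar>(if enat i < fst (N \<omega>) then 1 + \<bar>s m (snd (N \<omega>) i)\<bar> else 1) - 1\<bar>)"
        by (rule summable_finite[OF elim]) auto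
      from incseq_le[OF P_inc seq_prod_LIMSEQ[OF this]] show ?case
        by (simp add: sample_prod_def)
    qed
    have "(\<integral>\<^sup>+\<omega>. ennreal (?P (\<lambda>x. \<bar>s m x\<bar>) n \<omega>) \<partial>M) \<le>
        (\<integral>\<^sup>+\<omega>. ennreal (sample_prod (\<lambda>x. 1 + \<bar>s m x\<bar>) (N \<omega>)) \<partial>M)"
      using le by (intro nn_integral_mono_AE) (auto intro: ennreal_leI)
    also have "\<dots> = ennreal (\<integral>\<omega>. sample_prod (\<lambda>x. 1 + \<bar>s m x\<bar>) (N \<omega>) \<partial>M)"
    proof (rule nn_integral_eq_integral[OF simple(2)])
      show "AE \<omega> in M. 0 \<le> sample_prod (\<lambda>x. 1 + \<bar>s m x\<bar>) (N \<omega>)"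
        using le by eventually_elim (rule order_trans[OF P_pos[of "\<lambda>x. \<bar>s m x\<bar>"]], simp_all)
    qed
    also have "\<dots> \<le> ennreal (exp (2 * (\<integral>x. g x \<partial>\<mu>)))"
    proof -
      have "(\<integral>x. \<bar>s m x\<bar> \<partial>\<mu>) \<le> (\<integral>x. 2 * g x \<partial>\<mu>)"
        by (rule integral_mono_AE') (use g s(3) in auto)
      then show ?thesis using simple(3) by (intro ennreal_leI) simp
    qed
    finally show ?thesis .
  qed
  have "(\<integral>\<^sup>+\<omega>. ennreal (?P g n \<omega>) \<partial>M) \<le> ennreal (exp (2 * (\<integral>x. g x \<partial>\<mu>)))" for n
  proof -
    have "(\<lambda>m. ennreal (?P (\<lambda>x. \<bar>s m x\<bar>) n \<omega>)) \<longlonglongrightarrow> ennreal (?P g n \<omega>)" for \<omega>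
    proof (intro tendsto_ennrealI tendsto_prod)
      fix i
      have "(\<lambda>m. 1 + \<bar>s m (snd (N \<omega>) i)\<bar>) \<longlonglongrightarrow> 1 + \<bar>g (snd (N \<omega>) i)\<bar>"
        by (intro tendsto_intros s(2))
      then show "(\<lambda>m. if enat i < fst (N \<omega>) then 1 + \<bar>s m (snd (N \<omega>) i)\<bar> else 1) \<longlonglongrightarrow>
          (if enat i < fst (N \<omega>) then 1 + g (snd (N \<omega>) i) else 1)"
        using g(2) by simp
    qed
    then have "(\<integral>\<^sup>+\<omega>. ennreal (?P g n \<omega>) \<partial>M) =
        (\<integral>\<^sup>+\<omega>. liminf (\<lambda>m. ennreal (?P (\<lambda>x. \<bar>s m x\<bar>) n \<omega>)) \<partial>M)"
      by (intro nn_integral_cong lim_imp_Liminf[symmetric]) auto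
    also have "\<dots> \<le> liminf (\<lambda>m. \<integral>\<^sup>+\<omega>. ennreal (?P (\<lambda>x. \<bar>s m x\<bar>) n \<omega>) \<partial>M)"
    proof (rule nn_integral_liminf)
      fix m
      have [measurable]: "s m \<in> borel_measurable borel"
        using borel_measurable_simple_function[OF s(1)] by (simp add: measurable_cong_sets[OF \<mu> refl])
      show "(\<lambda>\<omega>. ennreal (?P (\<lambda>x. \<bar>s m x\<bar>) n \<omega>)) \<in> borel_measurable M" by measurable
    qed
    also have "\<dots> \<le> ennreal (exp (2 * (\<integral>x. g x \<partial>\<mu>)))"
      using bound_s by (intro Liminf_le always_eventually) auto
    finally show ?thesis .
  qed
  moreover have "(\<integral>\<^sup>+\<omega>. (SUP n. ennreal (?P g n \<omega>)) \<partial>M) = (SUP n. \<integral>\<^sup>+\<omega>. ennreal (?P g n \<omega>) \<partial>M)"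
  proof (rule nn_integral_monotone_convergence_SUP)
    show "incseq (\<lambda>n \<omega>. ennreal (?P g n \<omega>))"
      using P_inc[of g] g(2) by (auto simp: incseq_def le_fun_def intro!: ennreal_leI)
  qed measurable
  ultimately show ?thesis by (auto intro: SUP_least)
qed

text \<open>Simple functions with |F m| \<le> 2 |s| approximate s. Tannery's theorem gives
  convergence of the products for almost every outcome, and all of them are dominated by the
  supremum \<open>D\<close> of the products of 1 + 2 |s|, which has finite expectation.\<close>

theorem poisson_PGFl:
  fixes \<mu> :: "'a::topological_space measure" and s :: "'a \<Rightarrow> real"
  assumes prob: "prob_space M" and \<mu>: "sets \<mu> = sets borel" and N: "poisson_process M \<mu> N"
    and int: "integrable \<mu> s"
  shows "(\<integral>\<omega>. sample_prod (\<lambda>x. 1 + s x) (N \<omega>) \<partial>M) = exp (\<integral>x. s x \<partial>\<mu>)"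
proof -
  interpret prob_space M by fact
  have sp: "space \<mu> = UNIV" using sets_eq_imp_space_eq[OF \<mu>] by simp
  have [measurable]: "N \<in> M \<rightarrow>\<^sub>M sample_space" using N by (simp add: poisson_process_def)
  have \<mu>_m: "u \<in> borel_measurable borel" if "u \<in> borel_measurable \<mu>" for u :: "'a \<Rightarrow> real"
    using that by (simp add: measurable_cong_sets[OF \<mu> refl])
  have [measurable]: "s \<in> borel_measurable borel" using int by (intro \<mu>_m) auto
  obtain F where F: "\<And>m. simple_function \<mu> (F m)" "\<And>x. (\<lambda>m. F m x) \<longlonglongrightarrow> s x"
    and F_le: "\<And>m x. \<bar>F m x\<bar> \<le> 2 * \<bar>s x\<bar>"
    using borel_measurable_implies_sequence_metric[OF borel_measurable_integrable[OF int], of 0]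
    by (auto simp: sp)
  have [measurable]: "F m \<in> borel_measurable borel" for m
    using borel_measurable_simple_function[OF F(1)] by (rule \<mu>_m)
  have int_F: "integrable \<mu> (F m)" for m
    by (rule Bochner_Integration.integrable_bound[OF integrable_mult_right[OF integrable_abs[OF int], of 2]])
      (use F F_le in \<open>auto intro: borel_measurable_simple_function\<close>)
  have supp: "emeasure \<mu> {x \<in> space \<mu>. F m x \<noteq> 0} \<noteq> \<infinity>" for m
  proof -
    have "Bochner_Integration.simple_bochner_integrable \<mu> (F m)"
      using F(1)[of m] int_F[of m]
      by (intro simple_bochner_integrableI_bounded) (auto simp: integrable_iff_bounded)
    then show ?thesis by (simp add: simple_bochner_integrable.simps)
  qed
  note simple = poisson_PGFl_simple[OF prob \<mu> N F(1) supp]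
  define c where "c \<omega> i = (if enat i < fst (N \<omega>) then 2 * \<bar>s (snd (N \<omega>) i)\<bar> else 0)" for \<omega> i
  have c0: "0 \<le> c \<omega> i" for \<omega> i by (simp add: c_def)
  have [measurable]: "(\<lambda>\<omega>. c \<omega> i) \<in> borel_measurable M" for i unfolding c_def by measurable
  define D where "D \<omega> = (SUP n. ennreal (\<Prod>i<n. 1 + c \<omega> i))" for \<omega>
  have [measurable]: "D \<in> borel_measurable M" unfolding D_def by measurable
  have D_eq: "D \<omega> = (SUP n. ennreal (\<Prod>i<n. if enat i < fst (N \<omega>) then 1 + 2 * \<bar>s (snd (N \<omega>) i)\<bar> else 1))" for \<omega>
    unfolding D_def c_def by (intro SUP_cong refl arg_cong[where f = ennreal] prod.cong) auto
  have "(\<integral>\<^sup>+\<omega>. D \<omega> \<partial>M) \<le> ennreal (exp (2 * (\<integral>x. 2 * \<bar>s x\<bar> \<partial>\<mu>)))"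
    unfolding D_eq by (rule poisson_PGFl_bound[OF prob \<mu> N]) (use int in auto)
  also have "\<dots> < \<infinity>" by simp
  finally have D_fin: "(\<integral>\<^sup>+\<omega>. D \<omega> \<partial>M) < \<infinity>" .
  then have D_AE: "AE \<omega> in M. D \<omega> \<noteq> \<infinity>"
    by (intro nn_integral_PInf_AE) auto
  have D_le: "(\<Prod>i<n. 1 + c \<omega> i) \<le> enn2real (D \<omega>)" if "D \<omega> \<noteq> \<infinity>" for n \<omega>
  proof -
    have "ennreal (\<Prod>i<n. 1 + c \<omega> i) \<le> D \<omega>" unfolding D_def by (rule SUP_upper) simp
    then have "enn2real (ennreal (\<Prod>i<n. 1 + c \<omega> i)) \<le> enn2real (D \<omega>)"
      using that by (intro enn2real_mono) (auto simp: less_top)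
    moreover have "0 \<le> (\<Prod>i<n. 1 + c \<omega> i)" using c0 by (intro prod_nonneg) (auto simp: add_nonneg_nonneg)
    ultimately show ?thesis by simp
  qed
  \<comment> \<open>Finiteness of the product bounds the sum: \<Sum> c i \<le> \<Prod> (1 + c i) for
    nonnegative terms.\<close>
  have c_sm: "summable (c \<omega>)" if "D \<omega> \<noteq> \<infinity>" for \<omega>
  proof (rule bounded_imp_summable)
    fix n
    have "(\<Sum>i\<le>n. c \<omega> i) \<le> (\<Prod>i\<le>n. 1 + c \<omega> i)" 
      using c0 by (intro sum_le_prod) auto
    also have "\<dots> = (\<Prod>i<Suc n. 1 + c \<omega> i)" by (simp add: lessThan_Suc_atMost)
    also have "\<dots> \<le> enn2real (D \<omega>)" by (rule D_le[OF that])
    finally show "(\<Sum>i\<le>n. c \<omega> i) \<le> enn2real (D \<omega>)" .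
  qed (rule c0)
  have bound: "\<bar>(if enat i < fst (N \<omega>) then 1 + F m (snd (N \<omega>) i) else 1) - 1\<bar> \<le> c \<omega> i" for i m \<omega>
    using F_le by (auto simp: c_def)
  have sp_le: "\<bar>sample_prod (\<lambda>x. 1 + F m x) (N \<omega>)\<bar> \<le> enn2real (D \<omega>)" if D: "D \<omega> \<noteq> \<infinity>" for m \<omega>
  proof -
    let ?a = "\<lambda>i. if enat i < fst (N \<omega>) then 1 + F m (snd (N \<omega>) i) else 1"
    have "summable (\<lambda>i. \<bar>?a i - 1\<bar>)"
      using bound by (intro summable_comparison_test'[OF c_sm[OF D], of 0]) auto
    then have "(\<lambda>n. \<bar>\<Prod>i<n. ?a i\<bar>) \<longlonglongrightarrow> \<bar>seq_prod ?a\<bar>"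
      by (intro tendsto_intros seq_prod_LIMSEQ)
    moreover have "\<bar>\<Prod>i<n. ?a i\<bar> \<le> enn2real (D \<omega>)" for n
    proof -
      have "\<bar>?a i\<bar> \<le> 1 + c \<omega> i" for i using bound[of i \<omega> m] by linarith
      then have "\<bar>\<Prod>i<n. ?a i\<bar> \<le> (\<Prod>i<n. 1 + c \<omega> i)"
        unfolding abs_prod by (intro prod_mono) auto
      also note D_le[OF D]
      finally show ?thesis .
    qed
    ultimately show ?thesis
      unfolding sample_prod_def by (intro LIMSEQ_le_const2) auto
  qed
  have "(\<lambda>m. \<integral>\<omega>. sample_prod (\<lambda>x. 1 + F m x) (N \<omega>) \<partial>M) \<longlonglongrightarrow> (\<integral>\<omega>. sample_prod (\<lambda>x. 1 + s x) (N \<omega>) \<partial>M)"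
  proof (rule integral_dominated_convergence[where w = "\<lambda>\<omega>. enn2real (D \<omega>)"])
    show "integrable M (\<lambda>\<omega>. enn2real (D \<omega>))"
    proof (rule integrableI_nonneg)
      have "(\<integral>\<^sup>+\<omega>. ennreal (enn2real (D \<omega>)) \<partial>M) = (\<integral>\<^sup>+\<omega>. D \<omega> \<partial>M)"
        using D_AE by (intro nn_integral_cong_AE) (auto simp: less_top)
      then show "(\<integral>\<^sup>+\<omega>. ennreal (enn2real (D \<omega>)) \<partial>M) < \<infinity>" using D_fin by simp
    qed auto
    show "AE \<omega> in M. norm (sample_prod (\<lambda>x. 1 + F m x) (N \<omega>)) \<le> enn2real (D \<omega>)" for m
      using D_AE by eventually_elim (simp add: sp_le)
    show "AE \<omega> in M. (\<lambda>m. sample_prod (\<lambda>x. 1 + F m x) (N \<omega>)) \<longlonglongrightarrow> sample_prod (\<lambda>x. 1 + s x) (N \<omega>)"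
      using D_AE
    proof eventually_elim
      case (elim \<omega>)
      show ?case
        unfolding sample_prod_def
      proof (rule seq_prod_tannery(1)[OF _ bound c_sm[OF elim]])
        fix i
        show "(\<lambda>m. if enat i < fst (N \<omega>) then 1 + F m (snd (N \<omega>) i) else 1) \<longlonglongrightarrow>
            (if enat i < fst (N \<omega>) then 1 + s (snd (N \<omega>) i) else 1)"
          using tendsto_add[OF tendsto_const F(2)] by simp
      qed
    qed
  qed auto
  moreover have "(\<lambda>m. exp (\<integral>x. F m x \<partial>\<mu>)) \<longlonglongrightarrow> exp (\<integral>x. s x \<partial>\<mu>)"
  proof (intro tendsto_exp integral_dominated_convergence[where w = "\<lambda>x. 2 * \<bar>s x\<bar>"])
    show "AE x in \<mu>. (\<lambda>m. F m x) \<longlonglongrightarrow> s x" using F(2) by simp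
    show "AE x in \<mu>. norm (F m x) \<le> 2 * \<bar>s x\<bar>" for m using F_le by simp
  qed (use int int_F in auto)
  ultimately show ?thesis unfolding simple(3) by (rule LIMSEQ_unique)
qed

text \<open>
  For \<open>[0, 1]\<close>-valued functions the exponent may be \<open>-\<infinity>\<close>; the expectation is then obtained by
  exhausting the space with balls.
\<close>

definition poisson_unit_PGFl :: "'a::euclidean_space measure \<Rightarrow> ('a \<Rightarrow> real) \<Rightarrow> real" where
  "poisson_unit_PGFl \<mu> h = lim (\<lambda>m. exp (\<integral>x. indicator (ball 0 (real m)) x * (h x - 1) \<partial>\<mu>))"

lemma poisson_unit_PGFl:
  fixes \<mu> :: "'a::euclidean_space measure" and h :: "'a \<Rightarrow> real"
  assumes prob: "prob_space M" and \<mu>: "radon_measure \<mu>" and N: "poisson_process M \<mu> N"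
    and h [measurable]: "h \<in> borel_measurable borel" and h01: "\<And>x. 0 \<le> h x \<and> h x \<le> 1"
  shows "(\<integral>\<omega>. sample_prod h (N \<omega>) \<partial>M) = poisson_unit_PGFl \<mu> h"
proof -
  interpret prob_space M by fact
  have [measurable]: "N \<in> M \<rightarrow>\<^sub>M sample_space" using N by (simp add: poisson_process_def)
  have sets_\<mu> [measurable_cong]: "sets \<mu> = sets borel" using \<mu> by (simp add: radon_measure_def)
  let ?s = "\<lambda>m x. indicator (ball 0 (real m)) x * (h x - 1)"
  have ball_fin: "emeasure \<mu> (ball 0 (real m)) < \<infinity>" for m
  proof -
    have "emeasure \<mu> (ball 0 (real m)) \<le> emeasure \<mu> (cball 0 (real m))"
      by (intro emeasure_mono) (auto simp: sets_\<mu>)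
    also have "\<dots> < \<infinity>" using \<mu> by (simp add: radon_measure_def)
    finally show ?thesis .
  qed
  have [measurable]: "ball 0 (real m) \<in> sets borel" for m by simp
  have h\<mu> [measurable]: "h \<in> borel_measurable \<mu>" by (simp add: measurable_cong_sets[OF sets_\<mu> refl])
  have [measurable]: "ball 0 (real m) \<in> sets \<mu>" for m by (simp add: sets_\<mu>)
  have int: "integrable \<mu> (?s m)" for m
  proof (rule Bochner_Integration.integrable_bound)
    show "integrable \<mu> (indicator (ball 0 (real m)) :: 'a \<Rightarrow> real)"
      using ball_fin by (intro integrable_real_indicator) (auto simp: sets_\<mu>)
    show "AE x in \<mu>. norm (?s m x) \<le> norm (indicator (ball 0 (real m)) x :: real)"
    proof (rule AE_I2)
      fix x show "norm (?s m x) \<le> norm (indicator (ball 0 (real m)) x :: real)"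
        using h01[of x] by (auto simp: indicator_def)
    qed
  qed measurable
  have s01: "0 \<le> 1 + ?s m x \<and> 1 + ?s m x \<le> 1" for m x
    using h01[of x] by (auto simp: indicator_def)
  define a where "a m \<omega> i = (if enat i < fst (N \<omega>) then 1 + ?s m (snd (N \<omega>) i) else 1)" for m \<omega> i
  define b where "b \<omega> i = (if enat i < fst (N \<omega>) then h (snd (N \<omega>) i) else 1)" for \<omega> i
  have a01: "0 \<le> a m \<omega> i \<and> a m \<omega> i \<le> 1" for m \<omega> i using s01 by (auto simp: a_def)
  have b01: "0 \<le> b \<omega> i \<and> b \<omega> i \<le> 1" for \<omega> i using h01 by (auto simp: b_def)
  \<comment> \<open>The two limits are exchanged by monotonicity, without any summability. Each
    \<open>a m\<close> dominates \<open>b\<close> factorwise, which bounds the limit from below.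
    From above, a finite subproduct of \<open>b\<close> already below y coincides with that of
    \<open>a m\<close> once the ball contains its points.\<close>
  have lim_ab: "(\<lambda>m. seq_prod (a m \<omega>)) \<longlonglongrightarrow> seq_prod (b \<omega>)" for \<omega>
  proof (rule order_tendstoI)
    fix y assume y: "y < seq_prod (b \<omega>)"
    have "b \<omega> i \<le> a m \<omega> i" for m i
      using h01 by (auto simp: a_def b_def indicator_def)
    then have "seq_prod (b \<omega>) \<le> seq_prod (a m \<omega>)" for m
      using a01 b01
      by (intro LIMSEQ_le[OF seq_prod_LIMSEQ_unit seq_prod_LIMSEQ_unit]) (auto intro!: prod_mono)
    then show "\<forall>\<^sub>F m in sequentially. y < seq_prod (a m \<omega>)"
      by (intro always_eventually allI less_le_trans[OF y])
  next
    fix y assume "seq_prod (b \<omega>) < y"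
    from order_tendstoD(2)[OF seq_prod_LIMSEQ_unit[OF b01] this]
    obtain n where n: "(\<Prod>i<n. b \<omega> i) < y" by (auto simp: eventually_sequentially)
    \<comment> \<open>The inserted 0 keeps the set nonempty, and \<open>Max\<close> meaningful, when
      n = 0.\<close>
    obtain K :: nat where K: "Max (insert 0 ((\<lambda>i. norm (snd (N \<omega>) i)) ` {..<n})) < real K"
      using reals_Archimedean2 by blast
    have "seq_prod (a m \<omega>) < y" if "K \<le> m" for m
    proof -
      have in_ball: "snd (N \<omega>) i \<in> ball 0 (real m)" if "i < n" for i
      proof -
        have "norm (snd (N \<omega>) i) < real K" using K that by simp
        also have "\<dots> \<le> real m" using \<open>K \<le> m\<close> by simp
        finally show ?thesis by simp
      qed
      have "decseq (\<lambda>n. \<Prod>i<n. a m \<omega> i)"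
        using a01 by (intro decseq_SucI) (simp add: mult_left_le prod_nonneg)
      then have "seq_prod (a m \<omega>) \<le> (\<Prod>i<n. a m \<omega> i)"
        by (rule decseq_ge[OF _ seq_prod_LIMSEQ_unit[OF a01]])
      also have "\<dots> = (\<Prod>i<n. b \<omega> i)"
        using in_ball by (intro prod.cong) (auto simp: a_def b_def)
      finally show ?thesis using n by simp
    qed
    then show "\<forall>\<^sub>F m in sequentially. seq_prod (a m \<omega>) < y" by (rule eventually_sequentiallyI)
  qed
  have le1: "\<bar>seq_prod c\<bar> \<le> 1" if "\<And>i. 0 \<le> c i \<and> c i \<le> 1" for c :: "nat \<Rightarrow> real"
    using that by (intro LIMSEQ_le_const2[OF tendsto_rabs[OF seq_prod_LIMSEQ_unit]])
      (auto simp: abs_prod intro!: prod_le_1)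
  have "(\<lambda>m. \<integral>\<omega>. sample_prod (\<lambda>x. 1 + ?s m x) (N \<omega>) \<partial>M) \<longlonglongrightarrow> (\<integral>\<omega>. sample_prod h (N \<omega>) \<partial>M)"
  proof (rule integral_dominated_convergence[where w = "\<lambda>_. 1"])
    show "AE \<omega> in M. (\<lambda>m. sample_prod (\<lambda>x. 1 + ?s m x) (N \<omega>)) \<longlonglongrightarrow> sample_prod h (N \<omega>)"
      using lim_ab by (simp add: sample_prod_def a_def[abs_def] b_def[abs_def])
    show "AE \<omega> in M. norm (sample_prod (\<lambda>x. 1 + ?s m x) (N \<omega>)) \<le> 1" for m
      using le1[OF a01] by (simp add: sample_prod_def a_def[abs_def])
  qed auto
  then show ?thesis
    unfolding poisson_unit_PGFl_def poisson_PGFl[OF prob sets_\<mu> N int] by (rule limI[symmetric])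
qed

section \<open>Clusters and superpositions of clusters\<close>

text \<open>The label set \<open>L\<close> serves two purposes: the lists of length at most n give
  the first generations, \<open>UNIV\<close> gives the entire cluster.\<close>

definition cluster_on :: "nat list set \<Rightarrow> 'a::real_vector \<Rightarrow> (nat list \<Rightarrow> 'a sample) \<Rightarrow> (nat list, 'a) config" where
  "cluster_on L z t = ({u. u \<in> L \<and> born t u}, \<lambda>u. z + displacement t u)"

definition hawkes_on ::
  "nat list set \<Rightarrow> 'a::real_vector sample \<Rightarrow> (nat \<Rightarrow> nat list \<Rightarrow> 'a sample) \<Rightarrow> (nat \<times> nat list, 'a) config" where
  "hawkes_on L r s = ({(j, u). u \<in> L \<and> enat j < fst r \<and> born (s j) u},
     \<lambda>(j, u). snd r j + displacement (s j) u)"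

text \<open>Labels carry the most recent generation first, so the descendants of the
  first-generation individual i are those whose label ends in i.\<close>

definition subtree_at :: "(nat list \<Rightarrow> 'a sample) \<Rightarrow> nat \<Rightarrow> nat list \<Rightarrow> 'a sample" where
  "subtree_at t i u = t (u @ [i])"

lemma hawkes_on_UNIV: "hawkes_on UNIV r s = hawkes_points r s"
  by (auto simp: hawkes_on_def hawkes_points_def sample_config_def)

text \<open>\<open>born\<close> recurses at the newest generation, whereas conditioning on the
  children of the root requires the oldest one to be split off.\<close>

lemma born_snoc: "born t (u @ [i]) \<longleftrightarrow> enat i < fst (t []) \<and> born (subtree_at t i) u"
  by (induction u) (auto simp: sample_config_def subtree_at_def)

lemma displacement_snoc:
  "displacement t (u @ [i]) = snd (t []) i + displacement (subtree_at t i) u"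
  by (induction u) (auto simp: sample_config_def subtree_at_def)

lemma sum_over_eq_nn_integral:
  "sum_over \<phi> \<xi> = (\<integral>\<^sup>+i. (if i \<in> fst \<xi> then \<phi> (snd \<xi> i) else 0) \<partial>count_space UNIV)"
  unfolding sum_over_def
  by (subst nn_integral_count_space_indicator) (auto intro!: nn_integral_cong simp: indicator_def)

lemma sum_over_hawkes_on:
  "sum_over \<phi> (hawkes_on L r s) =
    (\<Sum>i. if enat i < fst r then sum_over \<phi> (cluster_on L (snd r i) (s i)) else 0)"
proof -
  let ?F = "\<lambda>(j, u). if u \<in> L \<and> enat j < fst r \<and> born (s j) u
    then \<phi> (snd r j + displacement (s j) u) else 0"
  have "sum_over \<phi> (hawkes_on L r s) = (\<integral>\<^sup>+p. ?F p \<partial>count_space UNIV)"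
    unfolding sum_over_eq_nn_integral
    by (intro nn_integral_cong) (simp add: hawkes_on_def split: prod.split)
  also have "\<dots> = (\<integral>\<^sup>+j. \<integral>\<^sup>+u. ?F (j, u) \<partial>count_space UNIV \<partial>count_space UNIV)"
    by (rule nn_integral_fst_count_space[symmetric])
  also have "\<dots> = (\<integral>\<^sup>+j. (if enat j < fst r then sum_over \<phi> (cluster_on L (snd r j) (s j)) else 0)
      \<partial>count_space UNIV)"
    unfolding sum_over_eq_nn_integral
    by (intro nn_integral_cong) (auto simp: cluster_on_def intro!: nn_integral_cong)
  finally show ?thesis by (simp add: nn_integral_count_space_nat)
qed

section \<open>Splitting a cluster at its root and at its first generation\<close>

lemma nn_integral_count_space_insert:
  assumes "a \<notin> A"
  shows "(\<integral>\<^sup>+x. f x \<partial>count_space (insert a A)) = f a + (\<integral>\<^sup>+x. f x \<partial>count_space A)"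
proof -
  have "(\<integral>\<^sup>+x. f x \<partial>count_space (insert a A)) =
      (\<integral>\<^sup>+x. f x * indicator {a} x + f x * indicator A x \<partial>count_space UNIV)"
    using assms
    by (subst nn_integral_count_space_indicator) (auto intro!: nn_integral_cong simp: indicator_def)
  also have "\<dots> = f a + (\<integral>\<^sup>+x. f x \<partial>count_space A)"
    by (subst nn_integral_add) (auto simp: nn_integral_count_space_indicator)
  finally show ?thesis .
qed

lemma sum_over_cluster_descendants:
  "sum_over \<phi> (cluster_on UNIV z t) = \<phi> z + sum_over (\<lambda>x. \<phi> (z + x)) (descendants t)"
proof -
  have "{u. born t u} = insert [] {u. born t u \<and> u \<noteq> []}" by auto
  then show ?thesis
    unfolding sum_over_def cluster_on_def descendants_def
    by (simp add: nn_integral_count_space_insert)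
qed

text \<open>Generations up to n + 1 are the root together with n further generations below each of
  its children; the labels correspond through (i, u) \<mapsto> \<open>u @ [i]\<close>.\<close>

lemma sum_over_cluster_Suc:
  "sum_over \<phi> (cluster_on {u. length u \<le> Suc n} z t) =
    \<phi> z + sum_over (\<lambda>x. \<phi> (z + x)) (hawkes_on {u. length u \<le> n} (t []) (subtree_at t))"
proof -
  let ?B = "{u. length u \<le> Suc n \<and> born t u \<and> u \<noteq> []}"
  have *: "{u. length u \<le> Suc n \<and> born t u} = insert [] ?B" by auto
  have bij: "bij_betw (\<lambda>p. snd p @ [fst p]) (fst (hawkes_on {u. length u \<le> n} (t []) (subtree_at t))) ?B"
    unfolding bij_betw_def
  proof
    show "(\<lambda>p. snd p @ [fst p]) ` fst (hawkes_on {u. length u \<le> n} (t []) (subtree_at t)) = ?B"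
    proof (intro equalityI subsetI)
      fix v assume v: "v \<in> ?B"
      then obtain u i where "v = u @ [i]" by (cases v rule: rev_cases) auto
      then show "v \<in> (\<lambda>p. snd p @ [fst p]) ` fst (hawkes_on {u. length u \<le> n} (t []) (subtree_at t))"
        using v by (auto simp: hawkes_on_def born_snoc intro!: image_eqI[of _ _ "(i, u)"])
    qed (auto simp: hawkes_on_def born_snoc)
  qed (auto simp: inj_on_def)
  show ?thesis
    unfolding sum_over_def cluster_on_def
    by (simp add: * nn_integral_count_space_insert flip: nn_integral_bij_count_space[OF bij])
      (auto intro!: nn_integral_cong simp: hawkes_on_def displacement_snoc algebra_simps split: prod.split)
qed

text \<open>The descendants of the root are the points of a Hawkes configuration whose immigrants
  are the children of the root. Both \<open>config_prod\<close> and its definedness are invariant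
  under this relabelling.\<close>

lemma descendants_bij:
  "bij_betw (\<lambda>p. snd p @ [fst p]) (fst (hawkes_points (t []) (subtree_at t))) (fst (descendants t))"
  unfolding bij_betw_def
proof
  show "(\<lambda>p. snd p @ [fst p]) ` fst (hawkes_points (t []) (subtree_at t)) = fst (descendants t)"
  proof (intro equalityI subsetI)
    fix v assume v: "v \<in> fst (descendants t)"
    then obtain u i where "v = u @ [i]"
      by (cases v rule: rev_cases) (auto simp: descendants_def)
    then show "v \<in> (\<lambda>p. snd p @ [fst p]) ` fst (hawkes_points (t []) (subtree_at t))"
      using v by (auto simp: descendants_def hawkes_points_def sample_config_def born_snoc
          intro!: image_eqI[of _ _ "(i, u)"])
  qed (auto simp: descendants_def hawkes_points_def sample_config_def born_snoc)
qed (auto simp: inj_on_def)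

lemma descendants_position:
  "snd (descendants t) (snd p @ [fst p]) = snd (hawkes_points (t []) (subtree_at t)) p"
  by (cases p) (simp add: descendants_def hawkes_points_def sample_config_def displacement_snoc)

lemma config_prod_descendants:
  "config_prod f (descendants t) = config_prod f (hawkes_points (t []) (subtree_at t))"
proof -
  let ?e = "\<lambda>p. snd p @ [fst p :: nat]" and ?\<eta> = "hawkes_points (t []) (subtree_at t)"
  have inj: "inj_on ?e A" for A by (auto simp: inj_on_def)
  have "config_prod f (descendants t) =
      Lim (filtermap ((`) ?e) (finite_subsets_at_top (fst ?\<eta>))) (\<lambda>F. \<Prod>i\<in>F. f (snd (descendants t) i))"
    using descendants_bij[of t]
    by (simp add: config_prod_def filtermap_image_finite_subsets_at_top[OF inj] bij_betw_def)
  also have "\<dots> = Lim (finite_subsets_at_top (fst ?\<eta>)) (\<lambda>F. \<Prod>i\<in>?e ` F. f (snd (descendants t) i))"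
    by (simp add: Topological_Spaces.Lim_def filterlim_filtermap)
  also have "\<dots> = config_prod f ?\<eta>"
    unfolding config_prod_def by (simp add: prod.reindex[OF inj] descendants_position)
  finally show ?thesis .
qed

lemma config_prod_defined_descendants:
  "config_prod_defined f (descendants t) \<longleftrightarrow> config_prod_defined f (hawkes_points (t []) (subtree_at t))"
proof -
  let ?e = "\<lambda>p. snd p @ [fst p :: nat]" and ?\<eta> = "hawkes_points (t []) (subtree_at t)"
  have img: "fst (descendants t) = ?e ` fst ?\<eta>"
    using descendants_bij[of t] by (simp add: bij_betw_def)
  have "(\<lambda>i. \<bar>f (snd (descendants t) i) - 1\<bar>) summable_on fst (descendants t) \<longleftrightarrow>
      (\<lambda>p. \<bar>f (snd ?\<eta> p) - 1\<bar>) summable_on fst ?\<eta>"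
    using summable_on_reindex_bij_betw[OF descendants_bij[of t], of "\<lambda>i. \<bar>f (snd (descendants t) i) - 1\<bar>"]
    by (simp add: descendants_position)
  then show ?thesis
    by (simp add: config_prod_defined_def img descendants_position)
qed

text \<open>The sum is the cardinality of the set of negative factors. Being a natural number is
  what \<open>signed_prod_add\<close> asks for.\<close>

lemma neg_count_sum_over_nat:
  assumes "sum_over (neg_count \<circ> f) \<xi> \<noteq> \<top>"
  shows "\<exists>k::nat. sum_over (neg_count \<circ> f) \<xi> = of_nat k"
proof -
  let ?A = "{i \<in> fst \<xi>. f (snd \<xi> i) < 0}"
  have "sum_over (neg_count \<circ> f) \<xi> = (\<integral>\<^sup>+i. indicator ?A i \<partial>count_space (fst \<xi>))"
    unfolding sum_over_def by (intro nn_integral_cong) (auto simp: neg_count_def)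
  also have "\<dots> = emeasure (count_space (fst \<xi>)) ?A"
    by (rule nn_integral_indicator) simp
  finally show ?thesis
    using assms emeasure_count_space_infinite[of ?A "fst \<xi>"] emeasure_count_space_finite[of ?A "fst \<xi>"]
    by (cases "finite ?A") auto
qed

lemma signed_config_prod_cluster:
  assumes "config_prod_defined (\<lambda>x. f (z + x)) (descendants t)"
  shows "signed_config_prod f (cluster_on UNIV z t) = f z * config_prod (\<lambda>x. f (z + x)) (descendants t)"
proof -
  have c: "countable (fst (descendants t))" by simp
  obtain k where k: "sum_over (neg_count \<circ> (\<lambda>x. f (z + x))) (descendants t) = of_nat k"
    using neg_count_sum_over_nat config_prod_defined_finite(2)[OF assms c] by blast
  have n: "neg_count (f z) = of_nat (if f z < 0 then 1 else 0)" by (simp add: neg_count_def)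
  show ?thesis
    using signed_prod_add[OF n k]
    unfolding config_prod_eq_signed[OF assms c] signed_config_prod_def sum_over_cluster_descendants
    by (simp add: comp_def signed_prod_single)
qed

text \<open>Grouping by clusters preserves definedness. If all factors lie in [0, 1], so do the
  cluster products. Otherwise, with h_i the deviation of cluster i and H the total deviation, |W i -
  1| \<le> exp h_i - 1 \<le> h_i exp H, and the h_i are summable. This is the dichotomy under which
  expectations of independent products factorise.\<close>

lemma hawkes_points_product:
  fixes f :: "'a::real_vector \<Rightarrow> real"
  assumes defd: "config_prod_defined f (hawkes_points r s)"
  defines "W \<equiv> \<lambda>i. if enat i < fst r then signed_config_prod f (cluster_on UNIV (snd r i) (s i)) else 1"
  shows "(\<forall>i. 0 \<le> W i \<and> W i \<le> 1) \<or> summable (\<lambda>i. \<bar>W i - 1\<bar>)"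
    and "seq_prod W = config_prod f (hawkes_points r s)"
proof -
  let ?\<eta> = "hawkes_points r s" and ?C = "\<lambda>i. cluster_on UNIV (snd r i) (s i)"
  let ?t = "\<lambda>\<phi> i. if enat i < fst r then sum_over \<phi> (?C i) else 0"
  have c: "countable (fst ?\<eta>)" by simp
  have sums: "sum_over \<phi> ?\<eta> = (\<Sum>i. ?t \<phi> i)" for \<phi> :: "'a \<Rightarrow> ennreal"
    unfolding hawkes_on_UNIV[symmetric] by (rule sum_over_hawkes_on)
  have le: "?t \<phi> i \<le> sum_over \<phi> ?\<eta>" for \<phi> :: "'a \<Rightarrow> ennreal" and i
    unfolding sums using sum_le_suminf[of "?t \<phi>" "{i}"] by simp
  note fin = config_prod_defined_finite[OF defd c]
  \<comment> \<open>The induction also carries the integrality of the count, since the sign is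
    multiplicative only for natural numbers.\<close>
  have partial: "signed_prod (\<Sum>i<n. ?t (neg_part_ln \<circ> f) i) (\<Sum>i<n. ?t (pos_part_ln \<circ> f) i)
      (\<Sum>i<n. ?t (neg_count \<circ> f) i) = (\<Prod>i<n. W i) \<and> (\<exists>k. (\<Sum>i<n. ?t (neg_count \<circ> f) i) = of_nat k)" for n
  proof (induction n)
    case 0
    then show ?case by (auto intro: exI[of _ 0])
  next
    case (Suc n)
    then obtain k where k: "(\<Sum>i<n. ?t (neg_count \<circ> f) i) = of_nat k" by blast
    have "\<exists>k'. ?t (neg_count \<circ> f) n = of_nat k'"
    proof (cases "enat n < fst r")
      case True
      then have "sum_over (neg_count \<circ> f) (?C n) \<noteq> \<top>"
        using le[of n "neg_count \<circ> f"] fin(2) by (auto simp: top_unique)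
      then show ?thesis using True neg_count_sum_over_nat[of f "?C n"] by simp
    qed (auto intro: exI[of _ 0])
    then obtain k' where k': "?t (neg_count \<circ> f) n = of_nat k'" by blast
    have "signed_prod (?t (neg_part_ln \<circ> f) n) (?t (pos_part_ln \<circ> f) n) (?t (neg_count \<circ> f) n) = W n"
      by (simp add: W_def signed_config_prod_def)
    then show ?case
      using signed_prod_add[OF k k'] Suc k k' by (auto intro: exI[of _ "k + k'"])
  qed
  have "(\<lambda>n. \<Prod>i<n. W i) \<longlonglongrightarrow> signed_config_prod f ?\<eta>"
    unfolding signed_config_prod_def partial[THEN conjunct1, symmetric] sums
    by (intro tendsto_signed_prod summable_LIMSEQ) (use fin in \<open>auto simp: sums\<close>)
  then show "seq_prod W = config_prod f ?\<eta>"
    unfolding config_prod_eq_signed[OF defd c] by (rule seq_prod_eqI)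
  show "(\<forall>i. 0 \<le> W i \<and> W i \<le> 1) \<or> summable (\<lambda>i. \<bar>W i - 1\<bar>)"
    using config_prod_defined_cases[OF defd c]
  proof
    assume unit: "\<forall>i\<in>fst ?\<eta>. 0 \<le> f (snd ?\<eta> i) \<and> f (snd ?\<eta> i) \<le> 1"
    have "0 \<le> f (snd (?C i) u) \<and> f (snd (?C i) u) \<le> 1" if "enat i < fst r" "u \<in> fst (?C i)" for i u
      using unit[rule_format, of "(i, u)"] that
      by (simp add: hawkes_points_def cluster_on_def sample_config_def)
    then have "0 \<le> W i \<and> W i \<le> 1" for i
      using signed_config_prod_unit[of "?C i" f] by (auto simp: W_def)
    then show ?thesis by blast
  next
    assume H: "sum_over (deviation f) ?\<eta> \<noteq> \<top>"
    let ?h = "\<lambda>i. enn2real (?t (deviation f) i)" and ?H = "enn2real (sum_over (deviation f) ?\<eta>)"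
    have t_fin: "?t (deviation f) i \<noteq> \<top>" for i
      using le[of i "deviation f"] H by (auto simp: top_unique)
    have h_le: "?h i \<le> ?H" for i
      using le[of i "deviation f"] H by (intro enn2real_mono) (auto simp: less_top)
    have "(\<Sum>i. ennreal (?h i)) = (\<Sum>i. ?t (deviation f) i)"
      using t_fin by (intro suminf_cong ennreal_enn2real) (simp add: less_top)
    then have "summable ?h"
      using H unfolding sums by (intro summable_suminf_not_top) auto
    then have sm: "summable (\<lambda>i. ?h i * exp ?H)" by (rule summable_mult2)
    have "\<bar>W i - 1\<bar> \<le> ?h i * exp ?H" for i
    proof (cases "enat i < fst r")
      case True
      have "\<bar>W i - 1\<bar> \<le> exp (?h i) - 1"
        using signed_config_prod_deviation[of "?C i" f] t_fin[of i] True by (simp add: W_def)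
      \<comment> \<open>This is 1 - h \<le> exp (-h) multiplied by exp h.\<close>
      also have "\<dots> \<le> ?h i * exp (?h i)"
        using exp_ge_add_one_self[of "- ?h i"] mult_left_mono[of "1 - ?h i" "exp (- ?h i)" "exp (?h i)"]
        by (simp add: algebra_simps flip: exp_add)
      also have "\<dots> \<le> ?h i * exp ?H" using h_le[of i] by (intro mult_left_mono) auto
      finally show ?thesis .
    qed (simp add: W_def)
    then have "summable (\<lambda>i. \<bar>W i - 1\<bar>)"
      by (intro summable_comparison_test'[OF sm, of 0]) auto
    then show ?thesis ..
  qed
qed

section \<open>Branching families\<close>

abbreviation tree_space :: "(nat list \<Rightarrow> 'a::topological_space sample) measure" where
  "tree_space \<equiv> PiM UNIV (\<lambda>_. sample_space)"

text \<open>
  Local finiteness is left out because a subtree of a branching process inherits it only on the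
  event that its root is born.
\<close>

definition branching_family ::
  "'w measure \<Rightarrow> 'a::euclidean_space measure \<Rightarrow> ('w \<Rightarrow> nat list \<Rightarrow> 'a sample) \<Rightarrow> bool" where
  "branching_family M \<gamma> T \<longleftrightarrow> prob_space M \<and> (\<forall>u. poisson_process M \<gamma> (\<lambda>\<omega>. T \<omega> u)) \<and>
     prob_space.indep_vars M (\<lambda>_. sample_space) (\<lambda>u \<omega>. T \<omega> u) UNIV"

definition hawkes_family ::
  "'w measure \<Rightarrow> 'a::euclidean_space measure \<Rightarrow> 'a measure \<Rightarrow>
   ('w \<Rightarrow> 'a sample) \<Rightarrow> ('w \<Rightarrow> nat \<Rightarrow> nat list \<Rightarrow> 'a sample) \<Rightarrow> bool" where
  "hawkes_family M \<gamma> \<nu> R S \<longleftrightarrow> prob_space M \<and> poisson_process M \<nu> R \<and>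
     (\<forall>j u. poisson_process M \<gamma> (\<lambda>\<omega>. S \<omega> j u)) \<and>
     prob_space.indep_vars M (\<lambda>_. sample_space)
       (\<lambda>l \<omega>. case l of None \<Rightarrow> R \<omega> | Some (j, u) \<Rightarrow> S \<omega> j u) UNIV"

lemma (in prob_space) indep_vars_reindex_inj:
  assumes X: "indep_vars (\<lambda>_. K) X UNIV" and h: "inj h"
  shows "indep_vars (\<lambda>_. K) (\<lambda>j. X (h j)) UNIV"
proof -
  have "indep_vars (\<lambda>j. PiM {h j} (\<lambda>_. K)) (\<lambda>j \<omega>. restrict (\<lambda>i. X i \<omega>) {h j}) UNIV"
    using h by (intro indep_vars_restrict[OF X]) (auto simp: disjoint_family_on_def inj_def)
  from indep_vars_compose2[OF this, of "\<lambda>j x. x (h j)" "\<lambda>_. K"] show ?thesis by simp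
qed

text \<open>The offspring sample of the root becomes the immigrant sample, whence both intensities
  are \<gamma>. The relabelling sends \<open>None\<close> to the root and (i, u) to
  \<open>u @ [i]\<close>; it is injective and so preserves independence.\<close>

lemma branching_family_hawkes:
  assumes "branching_family M \<gamma> T"
  shows "hawkes_family M \<gamma> \<gamma> (\<lambda>\<omega>. T \<omega> []) (\<lambda>\<omega>. subtree_at (T \<omega>))"
proof -
  interpret prob_space M using assms by (simp add: branching_family_def)
  define h :: "(nat \<times> nat list) option \<Rightarrow> nat list" where
    "h = case_option [] (\<lambda>(i, u). u @ [i])"
  have "inj h"
  proof (rule injI)
    fix x y assume "h x = h y"
    then show "x = y" by (cases x; cases y) (auto simp: h_def)
  qed
  then have "indep_vars (\<lambda>_. sample_space) (\<lambda>l \<omega>. T \<omega> (h l)) UNIV"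
    using assms by (intro indep_vars_reindex_inj[where X = "\<lambda>u \<omega>. T \<omega> u" and h = h])
      (simp_all add: branching_family_def)
  moreover have "(\<lambda>l \<omega>. T \<omega> (h l)) =
      (\<lambda>l \<omega>. case l of None \<Rightarrow> T \<omega> [] | Some (j, u) \<Rightarrow> subtree_at (T \<omega>) j u)"
  proof (intro ext)
    fix l \<omega>
    show "T \<omega> (h l) = (case l of None \<Rightarrow> T \<omega> [] | Some (j, u) \<Rightarrow> subtree_at (T \<omega>) j u)"
      by (cases l) (auto simp: h_def subtree_at_def)
  qed
  ultimately have "indep_vars (\<lambda>_. sample_space)
      (\<lambda>l \<omega>. case l of None \<Rightarrow> T \<omega> [] | Some (j, u) \<Rightarrow> subtree_at (T \<omega>) j u) UNIV"
    by (simp only:)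
  then show ?thesis
    unfolding hawkes_family_def
  proof (intro conjI allI)
    show "poisson_process M \<gamma> (\<lambda>\<omega>. T \<omega> [])" "poisson_process M \<gamma> (\<lambda>\<omega>. subtree_at (T \<omega>) j u)" for j u
      using assms by (simp_all add: branching_family_def subtree_at_def)
  qed (rule prob_space_axioms)
qed

lemma hawkes_family_branching:
  assumes "hawkes_family M \<gamma> \<nu> R S"
  shows "branching_family M \<gamma> (\<lambda>\<omega>. S \<omega> j)"
proof -
  interpret prob_space M using assms by (simp add: hawkes_family_def)
  have "indep_vars (\<lambda>_. sample_space)
      (\<lambda>u \<omega>. case Some (j, u) of None \<Rightarrow> R \<omega> | Some (j, u) \<Rightarrow> S \<omega> j u) UNIV"
    using assms
    by (intro indep_vars_reindex_inj[where h = "\<lambda>u. Some (j, u)"])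
      (auto simp: hawkes_family_def inj_def)
  then show ?thesis using assms by (simp add: branching_family_def hawkes_family_def)
qed

lemma branching_family_measurable:
  assumes "branching_family M \<gamma> T"
  shows "T \<in> M \<rightarrow>\<^sub>M tree_space"
  by (rule measurable_PiM_single')
    (use assms in \<open>auto simp: branching_family_def poisson_process_def measurable_space\<close>)

text \<open>For different j the labels (j, u) form disjoint blocks, and functions of disjoint blocks
  of independent variables are independent.\<close>

lemma hawkes_family_indep_trees:
  assumes "hawkes_family M \<gamma> \<nu> R S"
  shows "prob_space.indep_vars M (\<lambda>_. tree_space) (\<lambda>j \<omega>. S \<omega> j) UNIV"
proof -
  interpret prob_space M using assms by (simp add: hawkes_family_def)
  let ?X = "\<lambda>l \<omega>. case l of None \<Rightarrow> R \<omega> | Some (j, u) \<Rightarrow> S \<omega> j u"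
  let ?K = "\<lambda>j. range (\<lambda>u. Some (j, u))"
  have "indep_vars (\<lambda>j. PiM (?K j) (\<lambda>_. sample_space)) (\<lambda>j \<omega>. restrict (\<lambda>l. ?X l \<omega>) (?K j)) UNIV"
    using assms by (intro indep_vars_restrict) (auto simp: hawkes_family_def disjoint_family_on_def)
  then have "indep_vars (\<lambda>_. tree_space)
      (\<lambda>j \<omega>. (\<lambda>x u. x (Some (j, u))) (restrict (\<lambda>l. ?X l \<omega>) (?K j))) UNIV"
  proof (rule indep_vars_compose2)
    fix j
    show "(\<lambda>x u. x (Some (j, u))) \<in> PiM (?K j) (\<lambda>_. sample_space) \<rightarrow>\<^sub>M tree_space"
      by (rule measurable_PiM_single') (auto intro!: measurable_component_singleton)
  qed
  then show ?thesis by simp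
qed

text \<open>The label \<open>None\<close> of the immigrants is separated from all other labels.
  Independence is stated as a product law, the form on which Fubini's theorem acts.\<close>

lemma hawkes_family_joint:
  fixes \<gamma> \<nu> :: "'a::euclidean_space measure"
  assumes "hawkes_family M \<gamma> \<nu> R S"
  shows "distr M sample_space R \<Otimes>\<^sub>M distr M (PiM UNIV (\<lambda>_. tree_space)) (\<lambda>\<omega> i. S \<omega> i) =
    distr M (sample_space \<Otimes>\<^sub>M PiM UNIV (\<lambda>_. tree_space)) (\<lambda>\<omega>. (R \<omega>, \<lambda>i. S \<omega> i))"
proof -
  interpret prob_space M using assms by (simp add: hawkes_family_def)
  let ?X = "\<lambda>l \<omega>. case l of None \<Rightarrow> R \<omega> | Some (j, u) \<Rightarrow> S \<omega> j u"
  let ?A = "{None :: (nat \<times> nat list) option}"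
  let ?PA = "PiM ?A (\<lambda>_. sample_space :: 'a sample measure)" and ?PB = "PiM (- ?A) (\<lambda>_. sample_space :: 'a sample measure)"
  let ?RA = "\<lambda>\<omega>. restrict (\<lambda>l. ?X l \<omega>) ?A" and ?RB = "\<lambda>\<omega>. restrict (\<lambda>l. ?X l \<omega>) (- ?A)"
  let ?f = "\<lambda>x. x (None :: (nat \<times> nat list) option)" and ?g = "\<lambda>x i u. x (Some (i, u))"
  let ?T = "PiM UNIV (\<lambda>_::nat. tree_space :: (nat list \<Rightarrow> 'a sample) measure)"
  have "indep_var ?PA ?RA ?PB ?RB"
    using assms by (intro indep_var_restrict) (auto simp: hawkes_family_def)
  then have rA [measurable]: "random_variable ?PA ?RA" and rB [measurable]: "random_variable ?PB ?RB"
    and eq: "distr M ?PA ?RA \<Otimes>\<^sub>M distr M ?PB ?RB = distr M (?PA \<Otimes>\<^sub>M ?PB) (\<lambda>\<omega>. (?RA \<omega>, ?RB \<omega>))"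
    unfolding indep_var_distribution_eq by auto
  have f [measurable]: "?f \<in> ?PA \<rightarrow>\<^sub>M sample_space" by (rule measurable_component_singleton) simp
  have g [measurable]: "?g \<in> ?PB \<rightarrow>\<^sub>M ?T"
    by (intro measurable_PiM_single' measurable_component_singleton)
      (auto simp: space_PiM)
  interpret A: prob_space "distr M ?PA ?RA" by (rule prob_space_distr) fact
  interpret B: prob_space "distr M ?PB ?RB" by (rule prob_space_distr) fact
  interpret Bg: prob_space "distr (distr M ?PB ?RB) ?T ?g" by (rule B.prob_space_distr) simp
  have "distr (distr M ?PA ?RA) sample_space ?f \<Otimes>\<^sub>M distr (distr M ?PB ?RB) ?T ?g =
      distr (distr M ?PA ?RA \<Otimes>\<^sub>M distr M ?PB ?RB) (sample_space \<Otimes>\<^sub>M ?T) (\<lambda>(x, y). (?f x, ?g y))"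
    by (rule pair_measure_distr) (use Bg.sigma_finite_measure_axioms in auto)
  also have "\<dots> = distr M (sample_space \<Otimes>\<^sub>M ?T) (\<lambda>\<omega>. (R \<omega>, \<lambda>i. S \<omega> i))"
    unfolding eq by (subst distr_distr) (auto simp: comp_def)
  also have "distr (distr M ?PA ?RA) sample_space ?f = distr M sample_space R"
    by (subst distr_distr) (auto simp: comp_def)
  also have "distr (distr M ?PB ?RB) ?T ?g = distr M ?T (\<lambda>\<omega> i. S \<omega> i)"
    by (subst distr_distr) (auto simp: comp_def)
  finally show ?thesis .
qed

lemma born_measurable [measurable]: "Measurable.pred tree_space (\<lambda>t. born t u)"
proof (induction u)
  case (Cons i u)
  note [measurable] = Cons.IH
  have [measurable]: "(\<lambda>t. t u) \<in> tree_space \<rightarrow>\<^sub>M sample_space" by (rule measurable_component_singleton) simp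
  show ?case unfolding born.simps sample_config_def fst_conv mem_Collect_eq by measurable
qed simp

lemma displacement_measurable [measurable]:
  "(\<lambda>t. displacement t u :: 'a::euclidean_space) \<in> borel_measurable tree_space"
proof (induction u)
  case (Cons i u)
  note [measurable] = Cons.IH
  have [measurable]: "(\<lambda>t. t u) \<in> tree_space \<rightarrow>\<^sub>M sample_space" by (rule measurable_component_singleton) simp
  have [measurable]: "(\<lambda>t. snd (t u) i) \<in> tree_space \<rightarrow>\<^sub>M borel"
    by (rule measurable_compose[OF _ sample_space_snd]) simp
  show ?case unfolding displacement.simps sample_config_def snd_conv by measurable
qed simp

text \<open>Joint measurability in root and tree is required because clusters are started at random
  points. The sum is an integral over countably many labels, so each label can be treated
  separately.\<close>

lemma sum_over_cluster_measurable [measurable]: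
  fixes \<phi> :: "'a::euclidean_space \<Rightarrow> ennreal"
  assumes [measurable]: "\<phi> \<in> borel_measurable borel"
  shows "(\<lambda>(z, t). sum_over \<phi> (cluster_on L z t)) \<in> borel_measurable (borel \<Otimes>\<^sub>M tree_space)"
proof -
  interpret sigma_finite_measure "count_space (UNIV :: nat list set)"
    by (rule sigma_finite_measure_count_space_countable) simp
  have "(\<lambda>(p, u). if u \<in> L \<and> born (snd p) u then \<phi> (fst p + displacement (snd p) u) else 0)
      \<in> borel_measurable ((borel \<Otimes>\<^sub>M tree_space) \<Otimes>\<^sub>M count_space UNIV)"
    unfolding measurable_pair_swap_iff[of _ "borel \<Otimes>\<^sub>M tree_space"]
    by (rule measurable_pair_measure_countable1) (simp, simp, measurable)
  from borel_measurable_nn_integral[OF this]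
  show ?thesis
    by (simp add: sum_over_eq_nn_integral cluster_on_def case_prod_unfold cong: if_cong)
qed

section \<open>The law of a cluster is determined by the offspring intensity\<close>

text \<open>
  The Laplace functional of the first \<open>n\<close> generations satisfies a recursion that mentions only the
  offspring intensity. Hence it does not depend on how the offspring samples are enumerated, and
  the clusters of different individuals may be compared even though their labelled laws differ.
\<close>

primrec cluster_laplace :: "'a::euclidean_space measure \<Rightarrow> ('a \<Rightarrow> ennreal) \<Rightarrow> nat \<Rightarrow> 'a \<Rightarrow> real" where
  "cluster_laplace \<gamma> \<phi> 0 z = exp_neg (\<phi> z)"
| "cluster_laplace \<gamma> \<phi> (Suc n) z =
     exp_neg (\<phi> z) * poisson_unit_PGFl \<gamma> (\<lambda>x. cluster_laplace \<gamma> \<phi> n (z + x))"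

lemma sum_over_translate:
  "sum_over (\<lambda>x. \<phi> (z + x)) (cluster_on L y t) = sum_over \<phi> (cluster_on L (z + y) t)"
  by (simp add: sum_over_def cluster_on_def add.assoc)

lemma exp_neg_sum_over_hawkes:
  "exp_neg (sum_over \<phi> (hawkes_on L r s)) =
    seq_prod (\<lambda>i. if enat i < fst r then exp_neg (sum_over \<phi> (cluster_on L (snd r i) (s i))) else 1)"
proof -
  let ?t = "\<lambda>i. if enat i < fst r then sum_over \<phi> (cluster_on L (snd r i) (s i)) else 0"
  have "exp_neg (?t i) =
      (if enat i < fst r then exp_neg (sum_over \<phi> (cluster_on L (snd r i) (s i))) else 1)" for i
    by simp
  with exp_neg_suminf[of ?t] show ?thesis
    unfolding sum_over_hawkes_on by (intro seq_prod_eqI[symmetric]) simp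
qed

text \<open>The factor of the root splits off, and the rest is a product over the first generation
  with independent subtrees as marks. The induction leaves \<open>T\<close> arbitrary, because its
  hypothesis is applied to every subtree: a branching family with the same intensity, but possibly
  with another labelled law.\<close>

lemma cluster_laplace:
  fixes \<gamma> :: "'a::euclidean_space measure"
  assumes \<gamma>: "radon_measure \<gamma>" and \<phi> [measurable]: "\<phi> \<in> borel_measurable borel"
    and "branching_family M \<gamma> T"
  shows "(\<integral>\<omega>. exp_neg (sum_over \<phi> (cluster_on {u. length u \<le> n} z (T \<omega>))) \<partial>M) = cluster_laplace \<gamma> \<phi> n z"
  using assms(3)
proof (induction n arbitrary: T z)
  case 0
  interpret prob_space M using 0 by (simp add: branching_family_def)
  have "{u. length u \<le> 0 \<and> born t u} = {[]}" for t :: "nat list \<Rightarrow> 'a sample" by auto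
  then show ?case
    by (simp add: sum_over_def cluster_on_def nn_integral_count_space_finite prob_space)
next
  case (Suc n)
  interpret prob_space M using Suc.prems by (simp add: branching_family_def)
  let ?L = "{u :: nat list. length u \<le> n}"
  let ?R = "\<lambda>\<omega>. T \<omega> []" and ?S = "\<lambda>\<omega>. subtree_at (T \<omega>)"
  let ?w = "\<lambda>x t. exp_neg (sum_over \<phi> (cluster_on ?L (z + x) t))"
  note H = branching_family_hawkes[OF Suc.prems]
  note [measurable] = branching_family_measurable[OF Suc.prems]
  have R: "poisson_process M \<gamma> ?R" using H by (simp add: hawkes_family_def)
  then have R_m [measurable]: "?R \<in> M \<rightarrow>\<^sub>M sample_space" by (simp add: poisson_process_def)
  have S_m [measurable]: "(\<lambda>\<omega>. ?S \<omega> i) \<in> M \<rightarrow>\<^sub>M tree_space" for i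
    by (rule branching_family_measurable[OF hawkes_family_branching[OF H]])
  \<comment> \<open>Measurability and the bounds 0 and 1 are not visible in the recursive formula;
    they are read off the expectation that the induction hypothesis provides for \<open>T\<close>
    itself.\<close>
  have L_eq: "cluster_laplace \<gamma> \<phi> n = (\<lambda>y. \<integral>\<omega>. exp_neg (sum_over \<phi> (cluster_on ?L y (T \<omega>))) \<partial>M)"
    using Suc.IH[OF Suc.prems] by auto
  have sum_m [measurable]: "(\<lambda>p. sum_over \<phi> (cluster_on ?L (fst p) (snd p))) \<in> borel_measurable (borel \<Otimes>\<^sub>M tree_space)"
    using sum_over_cluster_measurable[OF \<phi>, of ?L] by (simp add: case_prod_unfold)
  have L_m [measurable]: "cluster_laplace \<gamma> \<phi> n \<in> borel_measurable borel"
    unfolding L_eq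
  proof (rule borel_measurable_lebesgue_integral)
    have "(\<lambda>p. exp_neg (sum_over \<phi> (cluster_on ?L (fst (fst p, T (snd p))) (snd (fst p, T (snd p))))))
        \<in> borel_measurable (borel \<Otimes>\<^sub>M M)" by measurable
    then show "(\<lambda>(y, \<omega>). exp_neg (sum_over \<phi> (cluster_on ?L y (T \<omega>)))) \<in> borel_measurable (borel \<Otimes>\<^sub>M M)"
      by (simp add: case_prod_unfold)
  qed
  have L01: "0 \<le> cluster_laplace \<gamma> \<phi> n y \<and> cluster_laplace \<gamma> \<phi> n y \<le> 1" for y
    unfolding L_eq by (auto intro!: integral_nonneg_AE integral_le_const integrable_const_bound[of _ 1]
        measurable_compose[of "\<lambda>\<omega>. (y, T \<omega>)", OF _ measurable_compose[OF sum_m exp_neg_measurable], simplified])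
  have w_m: "case_prod ?w \<in> borel_measurable (borel \<Otimes>\<^sub>M tree_space)"
  proof -
    have "(\<lambda>p. exp_neg (sum_over \<phi> (cluster_on ?L (fst (z + fst p, snd p)) (snd (z + fst p, snd p)))))
        \<in> borel_measurable (borel \<Otimes>\<^sub>M tree_space)" by measurable
    then show ?thesis by (simp add: case_prod_unfold)
  qed
  have S_w: "(\<lambda>\<omega>. ?w x (?S \<omega> i)) \<in> borel_measurable M" for x i
    using measurable_compose[OF S_m measurable_Pair2[OF w_m, of x]] by simp
  let ?W = "\<lambda>\<omega> i. if enat i < fst (?R \<omega>) then ?w (snd (?R \<omega>) i) (?S \<omega> i) else 1"
  have step: "exp_neg (sum_over \<phi> (cluster_on {u. length u \<le> Suc n} z (T \<omega>))) =
      exp_neg (\<phi> z) * seq_prod (?W \<omega>)" for \<omega>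
    unfolding sum_over_cluster_Suc exp_neg_add exp_neg_sum_over_hawkes sum_over_translate by simp
  have W01: "0 \<le> ?W \<omega> i \<and> ?W \<omega> i \<le> 1" for \<omega> i by simp
  have "(\<integral>\<omega>. seq_prod (?W \<omega>) \<partial>M) =
      (\<integral>\<omega>. seq_prod (\<lambda>i. if enat i < fst (?R \<omega>) then cluster_laplace \<gamma> \<phi> n (z + snd (?R \<omega>) i) else 1) \<partial>M)"
  proof (rule marked_product_expectation[OF prob_space_axioms hawkes_family_indep_trees[OF H] R_m
        hawkes_family_joint[OF H] w_m])
    show "integrable M (\<lambda>\<omega>. ?w x (?S \<omega> i))" for x i
      by (rule integrable_const_bound[of _ 1]) (auto intro: S_w)
    show "(\<integral>\<omega>. ?w x (?S \<omega> i) \<partial>M) = cluster_laplace \<gamma> \<phi> n (z + x)" for x i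
      by (rule Suc.IH[OF hawkes_family_branching[OF H]])
    show "AE \<omega> in M. (\<forall>i. 0 \<le> ?W \<omega> i \<and> ?W \<omega> i \<le> 1) \<or> summable (\<lambda>i. \<bar>?W \<omega> i - 1\<bar>)"
      using W01 by blast
    have "(\<lambda>\<omega>. ?W \<omega> i) \<in> borel_measurable M" for i
    proof -
      have "(\<lambda>\<omega>. case_prod ?w (snd (?R \<omega>) i, ?S \<omega> i)) \<in> borel_measurable M"
        by (rule measurable_compose[OF _ w_m]) measurable
      then have [measurable]: "(\<lambda>\<omega>. ?w (snd (?R \<omega>) i) (?S \<omega> i)) \<in> borel_measurable M" by simp
      show ?thesis by measurable
    qed
    then have "(\<lambda>\<omega>. seq_prod (?W \<omega>)) \<in> borel_measurable M" by (rule seq_prod_measurable)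
    moreover have "\<bar>seq_prod (?W \<omega>)\<bar> \<le> 1" for \<omega>
      using exp_neg_sum_over_hawkes[of "\<lambda>x. \<phi> (z + x)" ?L "?R \<omega>" "?S \<omega>"]
      unfolding sum_over_translate by (metis abs_of_nonneg exp_neg_nonneg exp_neg_le_1)
    ultimately show "integrable M (\<lambda>\<omega>. seq_prod (?W \<omega>))"
      by (intro integrable_const_bound[of _ 1]) auto
  qed
  also have "\<dots> = (\<integral>\<omega>. sample_prod (\<lambda>x. cluster_laplace \<gamma> \<phi> n (z + x)) (?R \<omega>) \<partial>M)"
    by (simp add: sample_prod_def)
  also have "\<dots> = poisson_unit_PGFl \<gamma> (\<lambda>x. cluster_laplace \<gamma> \<phi> n (z + x))"
    by (rule poisson_unit_PGFl[OF prob_space_axioms \<gamma> R]) (use L01 in auto)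
  finally show ?case unfolding step by simp
qed

text \<open>The sums over n generations increase to the sum over the cluster, and
  \<open>exp_neg\<close> is bounded and continuous. As the left-hand side mentions neither
  \<open>M\<close> nor \<open>T\<close>, the limit is the same for all branching families with
  intensity \<gamma>.\<close>

lemma cluster_laplace_LIMSEQ:
  fixes \<gamma> :: "'a::euclidean_space measure"
  assumes \<gamma>: "radon_measure \<gamma>" and \<phi>: "\<phi> \<in> borel_measurable borel" and T: "branching_family M \<gamma> T"
  shows "(\<lambda>n. cluster_laplace \<gamma> \<phi> n z) \<longlonglongrightarrow> (\<integral>\<omega>. exp_neg (sum_over \<phi> (cluster_on UNIV z (T \<omega>))) \<partial>M)"
proof -
  interpret prob_space M using T by (simp add: branching_family_def)
  have m: "(\<lambda>\<omega>. exp_neg (sum_over \<phi> (cluster_on L z (T \<omega>)))) \<in> borel_measurable M" for L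
    using measurable_compose[OF branching_family_measurable[OF T]
        measurable_Pair2[OF sum_over_cluster_measurable[OF \<phi>, of L], of z]]
    by (auto intro: measurable_compose[OF _ exp_neg_measurable])
  have "(\<lambda>n. sum_over \<phi> (cluster_on {u. length u \<le> n} z t)) \<longlonglongrightarrow> sum_over \<phi> (cluster_on UNIV z t)" for t
    unfolding sum_over_eq_nn_integral
  proof (rule nn_integral_LIMSEQ)
    fix u
    show "(\<lambda>n. if u \<in> fst (cluster_on {u. length u \<le> n} z t) then \<phi> (snd (cluster_on {u. length u \<le> n} z t) u) else 0)
        \<longlonglongrightarrow> (if u \<in> fst (cluster_on UNIV z t) then \<phi> (snd (cluster_on UNIV z t) u) else 0)"
      by (intro tendsto_eventually eventually_sequentiallyI[of "length u"]) (auto simp: cluster_on_def)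
  qed (auto simp: incseq_def le_fun_def cluster_on_def)
  then have "(\<lambda>n. \<integral>\<omega>. exp_neg (sum_over \<phi> (cluster_on {u. length u \<le> n} z (T \<omega>))) \<partial>M) \<longlonglongrightarrow>
      (\<integral>\<omega>. exp_neg (sum_over \<phi> (cluster_on UNIV z (T \<omega>))) \<partial>M)"
    by (intro integral_dominated_convergence[where w = "\<lambda>_. 1"] m AE_I2 tendsto_exp_neg) auto
  then show ?thesis by (simp add: cluster_laplace[OF \<gamma> \<phi> T])
qed

section \<open>The joint law of the three products of a cluster\<close>

lemma signed_config_prod_cluster_measurable [measurable]:
  fixes f :: "'a::euclidean_space \<Rightarrow> real"
  assumes [measurable]: "f \<in> borel_measurable borel"
  shows "(\<lambda>(z, t). signed_config_prod f (cluster_on L z t)) \<in> borel_measurable (borel \<Otimes>\<^sub>M tree_space)"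
proof -
  have [measurable]: "(\<lambda>p. sum_over (\<psi> \<circ> f) (cluster_on L (fst p) (snd p))) \<in> borel_measurable (borel \<Otimes>\<^sub>M tree_space)"
    if [measurable]: "\<psi> \<in> borel_measurable borel" for \<psi> :: "real \<Rightarrow> ennreal"
    using sum_over_cluster_measurable[of "\<psi> \<circ> f" L] by (simp add: case_prod_unfold measurable_comp[OF assms that])
  show ?thesis
    unfolding signed_config_prod_def signed_prod_def signed_of_def case_prod_unfold fst_conv snd_conv by measurable
qed

definition cluster_vector :: "('a::euclidean_space \<Rightarrow> real) \<Rightarrow> 'a \<Rightarrow> (nat list \<Rightarrow> 'a sample) \<Rightarrow> real \<times> real \<times> real" where
  "cluster_vector f z t =
     (exp_neg (sum_over (neg_part_ln \<circ> f) (cluster_on UNIV z t)),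
      exp_neg (sum_over (pos_part_ln \<circ> f) (cluster_on UNIV z t)),
      exp_neg (sum_over (neg_count \<circ> f) (cluster_on UNIV z t)))"

lemma signed_config_prod_cluster_vector:
  "signed_config_prod f (cluster_on UNIV z t) = signed_of (cluster_vector f z t)"
  by (simp add: signed_config_prod_def signed_prod_def cluster_vector_def)

lemma cluster_vector_measurable [measurable]:
  fixes f :: "'a::euclidean_space \<Rightarrow> real"
  assumes f: "f \<in> borel_measurable borel"
  shows "cluster_vector f z \<in> tree_space \<rightarrow>\<^sub>M borel"
proof -
  have sum_m: "(\<lambda>t. sum_over (\<psi> \<circ> f) (cluster_on UNIV z t)) \<in> borel_measurable tree_space"
    if "\<psi> \<in> borel_measurable borel" for \<psi> :: "real \<Rightarrow> ennreal"
    using measurable_Pair2[OF sum_over_cluster_measurable[of "\<psi> \<circ> f" UNIV], of z] measurable_comp[OF f that]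
    by simp
  note [measurable] = sum_m[OF neg_part_ln_measurable] sum_m[OF pos_part_ln_measurable] sum_m[OF neg_count_measurable]
  have "cluster_vector f z \<in> tree_space \<rightarrow>\<^sub>M (borel \<Otimes>\<^sub>M (borel \<Otimes>\<^sub>M borel))"
    unfolding cluster_vector_def by measurable
  then show ?thesis by (simp add: borel_prod)
qed

text \<open>Powers of \<open>exp_neg\<close> become multiples in the exponent and products become
  sums. Each mixed moment of the triple is therefore the Laplace functional of a single nonnegative
  function, and \<open>cluster_laplace_LIMSEQ\<close> applies.\<close>

lemma cluster_vector_law:
  fixes \<gamma> :: "'a::euclidean_space measure" and f :: "'a \<Rightarrow> real" and z :: 'a
  assumes \<gamma>: "radon_measure \<gamma>" and f [measurable]: "f \<in> borel_measurable borel"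
    and T: "branching_family M \<gamma> T"
  defines "Q \<equiv> distr M borel (\<lambda>\<omega>. cluster_vector f z (T \<omega>))"
  shows "(\<lambda>\<omega>. cluster_vector f z (T \<omega>)) \<in> M \<rightarrow>\<^sub>M borel"
    and "prob_space Q"
    and "AE p in Q. p \<in> {0..1} \<times> {0..1} \<times> {0..1}"
    and "(\<lambda>n. cluster_laplace \<gamma> (\<lambda>x. of_nat a * neg_part_ln (f x) + of_nat b * pos_part_ln (f x) +
          of_nat c * neg_count (f x)) n z) \<longlonglongrightarrow> (\<integral>(x, y, w). x ^ a * y ^ b * w ^ c \<partial>Q)"
proof -
  interpret prob_space M using T by (simp add: branching_family_def)
  show Y_m: "(\<lambda>\<omega>. cluster_vector f z (T \<omega>)) \<in> M \<rightarrow>\<^sub>M borel"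
    by (rule measurable_compose[OF branching_family_measurable[OF T] cluster_vector_measurable[OF f]])
  show "prob_space Q" unfolding Q_def by (rule prob_space_distr[OF Y_m])
  have "closed ({0..1} \<times> {0..1} \<times> {0..1} :: (real \<times> real \<times> real) set)"
    by (intro closed_Times closed_atLeastAtMost)
  then show "AE p in Q. p \<in> {0..1} \<times> {0..1} \<times> {0..1}"
    unfolding Q_def by (subst AE_distr_iff[OF Y_m]) (auto simp: cluster_vector_def)
  let ?\<phi> = "\<lambda>x. of_nat a * neg_part_ln (f x) + of_nat b * pos_part_ln (f x) + of_nat c * neg_count (f x)"
  have moment: "(\<lambda>(x, y, w). x ^ a * y ^ b * w ^ c) (cluster_vector f z t) =
      exp_neg (sum_over ?\<phi> (cluster_on UNIV z t))" for t
    by (simp add: cluster_vector_def sum_over_def nn_integral_add nn_integral_cmult exp_neg_add exp_neg_of_nat_mult)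
  have "(\<lambda>(x, y, w). x ^ a * y ^ b * w ^ c :: real) \<in> borel_measurable (borel \<Otimes>\<^sub>M (borel \<Otimes>\<^sub>M borel))"
    by measurable
  then have "(\<lambda>(x, y, w). x ^ a * y ^ b * w ^ c :: real) \<in> borel_measurable borel"
    by (simp add: borel_prod)
  from integral_distr[OF Y_m this]
  have "(\<integral>(x, y, w). x ^ a * y ^ b * w ^ c \<partial>Q) =
      (\<integral>\<omega>. exp_neg (sum_over ?\<phi> (cluster_on UNIV z (T \<omega>))) \<partial>M)"
    unfolding moment Q_def .
  moreover have "?\<phi> \<in> borel_measurable borel" by measurable
  ultimately show "(\<lambda>n. cluster_laplace \<gamma> ?\<phi> n z) \<longlonglongrightarrow> (\<integral>(x, y, w). x ^ a * y ^ b * w ^ c \<partial>Q)"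
    using cluster_laplace_LIMSEQ[OF \<gamma> _ T] by simp
qed

text \<open>The moments of both triples are limits of the same sequence, so their laws agree.
  Passing through laws is essential: \<open>signed_of\<close> is unbounded and discontinuous on the
  cube, and equal moments alone would say nothing about its integrability. The second claim makes
  integrability available for subtrees and immigrant clusters.\<close>

lemma cluster_signed_config_prod_unique:
  fixes \<gamma> :: "'a::euclidean_space measure" and f :: "'a \<Rightarrow> real"
  assumes \<gamma>: "radon_measure \<gamma>" and f: "f \<in> borel_measurable borel"
    and T: "branching_family M \<gamma> T" and T': "branching_family M' \<gamma> T'"
  shows "(\<integral>\<omega>. signed_config_prod f (cluster_on UNIV z (T \<omega>)) \<partial>M) =
      (\<integral>\<omega>. signed_config_prod f (cluster_on UNIV z (T' \<omega>)) \<partial>M')"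
    and "integrable M (\<lambda>\<omega>. signed_config_prod f (cluster_on UNIV z (T \<omega>))) \<longleftrightarrow>
      integrable M' (\<lambda>\<omega>. signed_config_prod f (cluster_on UNIV z (T' \<omega>)))"
proof -
  note V = cluster_vector_law[OF \<gamma> f T, where z = z]
    and V' = cluster_vector_law[OF \<gamma> f T', where z = z]
  have law: "distr M borel (\<lambda>\<omega>. cluster_vector f z (T \<omega>)) = distr M' borel (\<lambda>\<omega>. cluster_vector f z (T' \<omega>))"
    by (rule measure_eqI_moments[OF V(2) _ V(3) V'(2) _ V'(3) LIMSEQ_unique[OF V(4) V'(4)]]) auto
  show "(\<integral>\<omega>. signed_config_prod f (cluster_on UNIV z (T \<omega>)) \<partial>M) =
      (\<integral>\<omega>. signed_config_prod f (cluster_on UNIV z (T' \<omega>)) \<partial>M')"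
    unfolding signed_config_prod_cluster_vector
    using integral_distr[OF V(1) signed_of_measurable] integral_distr[OF V'(1) signed_of_measurable] law
    by simp
  show "integrable M (\<lambda>\<omega>. signed_config_prod f (cluster_on UNIV z (T \<omega>))) \<longleftrightarrow>
      integrable M' (\<lambda>\<omega>. signed_config_prod f (cluster_on UNIV z (T' \<omega>)))"
    unfolding signed_config_prod_cluster_vector
    using integrable_distr_eq[OF V(1) signed_of_measurable] integrable_distr_eq[OF V'(1) signed_of_measurable] law
    by simp
qed

section \<open>The generating functionals\<close>

text \<open>Each cluster is replaced by its expected product, a function of the immigrant's
  position, and the generating functional of the immigrants is evaluated at that function.
  \<open>T\<close> is a reference family that defines this function; it may live on another
  probability space than the Hawkes family.\<close>

theorem hawkes_family_PGFl:
  fixes f :: "'a::euclidean_space \<Rightarrow> real" and \<gamma> \<nu> :: "'a measure"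
  defines "W \<equiv> \<lambda>z t. signed_config_prod f (cluster_on UNIV z t)"
  assumes \<gamma>: "radon_measure \<gamma>" and \<nu>: "radon_measure \<nu>" and f: "f \<in> borel_measurable borel"
    and T: "branching_family M \<gamma> T" and int: "\<And>z. integrable M (\<lambda>\<omega>. W z (T \<omega>))"
    and H: "hawkes_family M' \<gamma> \<nu> R S"
    and defd: "AE \<omega> in M'. config_prod_defined f (hawkes_points (R \<omega>) (S \<omega>))"
    and int_prod: "integrable M' (\<lambda>\<omega>. config_prod f (hawkes_points (R \<omega>) (S \<omega>)))"
    and int_\<nu>: "integrable \<nu> (\<lambda>z. (\<integral>\<omega>. W z (T \<omega>) \<partial>M) - 1)"
  shows "(\<integral>\<omega>. config_prod f (hawkes_points (R \<omega>) (S \<omega>)) \<partial>M') = exp (\<integral>z. (\<integral>\<omega>. W z (T \<omega>) \<partial>M) - 1 \<partial>\<nu>)"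
proof -
  interpret M': prob_space M' using H by (simp add: hawkes_family_def)
  let ?G = "\<lambda>z. \<integral>\<omega>. W z (T \<omega>) \<partial>M"
  let ?W = "\<lambda>\<omega> i. if enat i < fst (R \<omega>) then W (snd (R \<omega>) i) (S \<omega> i) else 1"
  have R: "poisson_process M' \<nu> R" using H by (simp add: hawkes_family_def)
  then have R_m [measurable]: "R \<in> M' \<rightarrow>\<^sub>M sample_space" by (simp add: poisson_process_def)
  have S_m [measurable]: "(\<lambda>\<omega>. S \<omega> i) \<in> M' \<rightarrow>\<^sub>M tree_space" for i
    by (rule branching_family_measurable[OF hawkes_family_branching[OF H]])
  have W_m: "case_prod W \<in> borel_measurable (borel \<Otimes>\<^sub>M tree_space)"
    unfolding W_def by (rule signed_config_prod_cluster_measurable[OF f])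
  have "(\<lambda>\<omega>. ?W \<omega> i) \<in> borel_measurable M'" for i
  proof -
    have "(\<lambda>\<omega>. case_prod W (snd (R \<omega>) i, S \<omega> i)) \<in> borel_measurable M'"
      by (rule measurable_compose[OF _ W_m]) measurable
    then have [measurable]: "(\<lambda>\<omega>. W (snd (R \<omega>) i) (S \<omega> i)) \<in> borel_measurable M'" by simp
    show ?thesis by measurable
  qed
  then have prod_m [measurable]: "(\<lambda>\<omega>. seq_prod (?W \<omega>)) \<in> borel_measurable M'"
    by (rule seq_prod_measurable)
  have eq: "AE \<omega> in M'. config_prod f (hawkes_points (R \<omega>) (S \<omega>)) = seq_prod (?W \<omega>)"
    using defd by eventually_elim (unfold W_def, rule hawkes_points_product(2)[symmetric])
  have "(\<integral>\<omega>. config_prod f (hawkes_points (R \<omega>) (S \<omega>)) \<partial>M') = (\<integral>\<omega>. seq_prod (?W \<omega>) \<partial>M')"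
    using eq by (intro integral_cong_AE) (use int_prod in auto)
  also have "\<dots> = (\<integral>\<omega>. seq_prod (\<lambda>i. if enat i < fst (R \<omega>) then ?G (snd (R \<omega>) i) else 1) \<partial>M')"
  proof (rule marked_product_expectation[OF M'.prob_space_axioms hawkes_family_indep_trees[OF H] R_m
        hawkes_family_joint[OF H] W_m])
    \<comment> \<open>Connects the cluster of each immigrant with the reference family:
      integrability and mean are both carried over.\<close>
    note unique = cluster_signed_config_prod_unique[OF \<gamma> f T hawkes_family_branching[OF H]]
    show "integrable M' (\<lambda>\<omega>. W z (S \<omega> i))" for z i
      using int[of z] unique(2) unfolding W_def by blast
    show "(\<integral>\<omega>. W z (S \<omega> i) \<partial>M') = ?G z" for z i
      using unique(1) unfolding W_def by metis
    show "AE \<omega> in M'. (\<forall>i. 0 \<le> ?W \<omega> i \<and> ?W \<omega> i \<le> 1) \<or> summable (\<lambda>i. \<bar>?W \<omega> i - 1\<bar>)"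
      using defd by eventually_elim (unfold W_def, rule hawkes_points_product(1))
    show "integrable M' (\<lambda>\<omega>. seq_prod (?W \<omega>))"
      by (rule integrable_cong_AE_imp[OF int_prod prod_m]) (use eq in \<open>auto simp: eq_commute\<close>)
  qed
  also have "\<dots> = (\<integral>\<omega>. sample_prod (\<lambda>x. 1 + (?G x - 1)) (R \<omega>) \<partial>M')"
    by (simp add: sample_prod_def)
  also have "\<dots> = exp (\<integral>z. ?G z - 1 \<partial>\<nu>)"
    by (rule poisson_PGFl[OF M'.prob_space_axioms _ R int_\<nu>]) (use \<nu> in \<open>simp add: radon_measure_def\<close>)
  finally show ?thesis .
qed

theorem proposition3p1:
  fixes f :: "'a::euclidean_space \<Rightarrow> real"
    and \<gamma> :: "'a measure"
    and M :: "'w measure"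
    and S :: "'w \<Rightarrow> nat list \<Rightarrow> 'a sample"
  assumes "radon_measure \<gamma>"
    and "branching_process M \<gamma> S"
    and "f \<in> borel_measurable borel"
    and "\<And>z. AE \<omega> in M. config_prod_defined (\<lambda>x. f (z + x)) (descendants (S \<omega>))"
    and "\<And>z. integrable M (\<lambda>\<omega>. config_prod (\<lambda>x. f (z + x)) (descendants (S \<omega>)))"
    and "\<And>z. integrable \<gamma> (\<lambda>x. cluster_PGFl M S f (z + x) - 1)"
  shows "(\<forall>z. cluster_PGFl M S f z =
              f z * exp (\<integral>x. (cluster_PGFl M S f (z + x) - 1) \<partial>\<gamma>)) \<and>
         (\<forall>(\<nu> :: 'a measure) (M' :: 'v measure) R S'.
            radon_measure \<nu> \<longrightarrow>
            hawkes_process M' \<gamma> \<nu> R S' \<longrightarrow>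
            (AE \<omega> in M'. config_prod_defined f (hawkes_points (R \<omega>) (S' \<omega>))) \<longrightarrow>
            integrable M' (\<lambda>\<omega>. config_prod f (hawkes_points (R \<omega>) (S' \<omega>))) \<longrightarrow>
            integrable \<nu> (\<lambda>z. cluster_PGFl M S f z - 1) \<longrightarrow>
            hawkes_PGFl M' R S' f = exp (\<integral>z. (cluster_PGFl M S f z - 1) \<partial>\<nu>))"
proof -
  note \<gamma> = assms(1) and f [measurable] = assms(3) and defd = assms(4) and int = assms(5) and int_\<gamma> = assms(6)
  have T: "branching_family M \<gamma> S"
    using assms(2) by (simp add: branching_process_def branching_family_def)
  let ?W = "\<lambda>z t. signed_config_prod f (cluster_on UNIV z t)"
  have W_m: "(\<lambda>\<omega>. ?W z (S \<omega>)) \<in> borel_measurable M" for z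
    using measurable_compose[OF branching_family_measurable[OF T]
        measurable_Pair2[OF signed_config_prod_cluster_measurable[OF f, of UNIV], of z]] by simp
  have W_eq: "AE \<omega> in M. f z * config_prod (\<lambda>x. f (z + x)) (descendants (S \<omega>)) = ?W z (S \<omega>)" for z
    using defd[of z] by eventually_elim (simp add: signed_config_prod_cluster)
  have W_int: "integrable M (\<lambda>\<omega>. ?W z (S \<omega>))" for z
    by (rule integrable_cong_AE_imp[OF integrable_mult_right[OF int[of z], of "f z"] W_m])
      (use W_eq[of z] in \<open>auto simp: eq_commute\<close>)
  \<comment> \<open>The factor of the ancestor is absorbed into a product over the whole cluster,
    the form that occurs for the clusters of a Hawkes family.\<close>
  have G: "cluster_PGFl M S f z = (\<integral>\<omega>. ?W z (S \<omega>) \<partial>M)" for z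
  proof -
    have "cluster_PGFl M S f z = (\<integral>\<omega>. f z * config_prod (\<lambda>x. f (z + x)) (descendants (S \<omega>)) \<partial>M)"
      by (simp add: cluster_PGFl_def)
    also have "\<dots> = (\<integral>\<omega>. ?W z (S \<omega>) \<partial>M)"
      using W_eq[of z] int[of z] W_m by (intro integral_cong_AE) auto
    finally show ?thesis .
  qed
  have "cluster_PGFl M S f z = f z * exp (\<integral>x. (cluster_PGFl M S f (z + x) - 1) \<partial>\<gamma>)" for z
  proof -
    \<comment> \<open>Translating the function is the same as translating the root.\<close>
    have shift: "signed_config_prod (\<lambda>x. f (z + x)) (cluster_on UNIV y t) = ?W (z + y) t" for y t
      unfolding signed_config_prod_def comp_def sum_over_translate[symmetric] ..
    \<comment> \<open>The functional of the Hawkes family is used with immigrant intensity \<gamma>,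
      the first generation as immigrants, and \<open>f\<close> translated by \<open>z\<close>. The
      process is here its own reference family.\<close>
    have "(\<integral>\<omega>. config_prod (\<lambda>x. f (z + x)) (hawkes_points (S \<omega> []) (subtree_at (S \<omega>))) \<partial>M) =
        exp (\<integral>x. (\<integral>\<omega>. signed_config_prod (\<lambda>x. f (z + x)) (cluster_on UNIV x (S \<omega>)) \<partial>M) - 1 \<partial>\<gamma>)"
    proof (rule hawkes_family_PGFl[OF \<gamma> \<gamma> _ T _ branching_family_hawkes[OF T]])
      show "(\<lambda>x. f (z + x)) \<in> borel_measurable borel" by measurable
      show "AE \<omega> in M. config_prod_defined (\<lambda>x. f (z + x)) (hawkes_points (S \<omega> []) (subtree_at (S \<omega>)))"
        using defd[of z] by (simp add: config_prod_defined_descendants)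
      show "integrable M (\<lambda>\<omega>. config_prod (\<lambda>x. f (z + x)) (hawkes_points (S \<omega> []) (subtree_at (S \<omega>))))"
        using int[of z] by (simp add: config_prod_descendants)
    qed (use W_int int_\<gamma>[of z] in \<open>simp_all add: shift G\<close>)
    then show ?thesis
      unfolding shift G[symmetric] by (simp add: cluster_PGFl_def config_prod_descendants)
  qed
  moreover have "hawkes_PGFl M' R S' f = exp (\<integral>z. (cluster_PGFl M S f z - 1) \<partial>\<nu>)"
    if "radon_measure \<nu>" "hawkes_process M' \<gamma> \<nu> R S'"
      "AE \<omega> in M'. config_prod_defined f (hawkes_points (R \<omega>) (S' \<omega>))"
      "integrable M' (\<lambda>\<omega>. config_prod f (hawkes_points (R \<omega>) (S' \<omega>)))"
      "integrable \<nu> (\<lambda>z. cluster_PGFl M S f z - 1)"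
    for \<nu> :: "'a measure" and M' :: "'v measure" and R S'
  proof -
    have "hawkes_family M' \<gamma> \<nu> R S'"
      using that(2) by (simp add: hawkes_process_def hawkes_family_def)
    from hawkes_family_PGFl[OF \<gamma> that(1) f T W_int this that(3,4) that(5)[unfolded G]]
    show ?thesis unfolding hawkes_PGFl_def G .
  qed
  ultimately show ?thesis by blast
qed

end
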